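(* Let $\mathcal{C}$ be an extension-closed pseudovariety of finite groups and suppose that $A$ and $B$ are non-trivial $\mathcal{C}$-cyclic subgroup separable groups. Then $A \wr B$ is $\mathcal{C}$-cyclic subgroup separable if and only if at least one of the following is true: (i) $B \in \mathcal{C}$; (ii) $A$ is abelian.
   Context: An extension-closed pseudovariety of finite groups is a (non-empty, isomorphism-closed) class of finite groups closed under subgroups, finite direct products, quotients and extensions. For a group $G$, the pro-$\mathcal{C}$ topology has as base of open sets all cosets $gN$ with $g\in G$ and $N \unlhd G$, $G/N \in \mathcal{C}$; a subset is $\mathcal{C}$-closed if it is closed in this topology. $G$ is $\mathcal{C}$-cyclic subgroup separable ($\mathcal{C}$-CSS) if every cyclic subgroup of $G$ (including the trivial one) is $\mathcal{C}$-closed in $G$. $A \wr B$ denotes the restricted wreath product $A^B \rtimes B$, where $A^B$ is the group of finitely supported functions $B\to A$, on which $B$ acts by left translation of coordinates. *)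

theory Defs
  imports "HOL-Algebra.Algebra" "HOL-Analysis.Abstract_Topology"
begin

text \<open>
  A class of finite groups closed under isomorphism is determined by its members whose
  elements are natural numbers, and it is represented by the set of these.  A group over an
  arbitrary type belongs to the class iff it is isomorphic to one of them.
\<close>

definition in_class :: "nat monoid set \<Rightarrow> ('a, 'm) monoid_scheme \<Rightarrow> bool"
  where "in_class \<C> G \<longleftrightarrow> group G \<and> (\<exists>H\<in>\<C>. G \<cong> H)"

locale extension_closed_pseudovariety =
  fixes \<C> :: "nat monoid set"
  assumes nonempty: "\<C> \<noteq> {}"
    and finite_groups: "G \<in> \<C> \<Longrightarrow> group G \<and> finite (carrier G)"
    and iso_closed: "\<lbrakk>G \<in> \<C>; group H; G \<cong> H\<rbrakk> \<Longrightarrow> H \<in> \<C>"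
    and subgroup_closed: "\<lbrakk>G \<in> \<C>; subgroup S G\<rbrakk> \<Longrightarrow> in_class \<C> (G\<lparr>carrier := S\<rparr>)"
    and product_closed: "\<lbrakk>G \<in> \<C>; H \<in> \<C>\<rbrakk> \<Longrightarrow> in_class \<C> (G \<times>\<times> H)"
    and quotient_closed: "\<lbrakk>G \<in> \<C>; N \<lhd> G\<rbrakk> \<Longrightarrow> in_class \<C> (G Mod N)"
    and extension_closed:
      "\<lbrakk>group G; N \<lhd> G; in_class \<C> (G\<lparr>carrier := N\<rparr>); in_class \<C> (G Mod N)\<rbrakk> \<Longrightarrow> G \<in> \<C>"

definition pro_base :: "nat monoid set \<Rightarrow> ('a, 'm) monoid_scheme \<Rightarrow> 'a set \<Rightarrow> bool"
  where "pro_base \<C> G U \<longleftrightarrow>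
    (\<exists>g\<in>carrier G. \<exists>N. N \<lhd> G \<and> in_class \<C> (G Mod N) \<and> U = g <#\<^bsub>G\<^esub> N)"

definition pro_topology :: "nat monoid set \<Rightarrow> ('a, 'm) monoid_scheme \<Rightarrow> 'a topology"
  where "pro_topology \<C> G = topology (arbitrary union_of (pro_base \<C> G))"

definition cyclic_subgroup_separable :: "nat monoid set \<Rightarrow> ('a, 'm) monoid_scheme \<Rightarrow> bool"
  where "cyclic_subgroup_separable \<C> G \<longleftrightarrow>
    (\<forall>g\<in>carrier G. closedin (pro_topology \<C> G) (generate G {g}))"

text \<open>
  The base group is the group of finitely supported functions from \<open>B\<close> to \<open>A\<close>, and \<open>b\<close> acts on
  it by \<open>(b \<cdot> f) x = f (b\<^sup>-\<^sup>1 x)\<close>.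
\<close>

definition left_translate ::
    "('b, 'n) monoid_scheme \<Rightarrow> 'b \<Rightarrow> ('b \<Rightarrow> 'a) \<Rightarrow> 'b \<Rightarrow> 'a"
  where "left_translate B b f = (\<lambda>x\<in>carrier B. f (inv\<^bsub>B\<^esub> b \<otimes>\<^bsub>B\<^esub> x))"

definition wreath ::
    "('a, 'm) monoid_scheme \<Rightarrow> ('b, 'n) monoid_scheme \<Rightarrow> (('b \<Rightarrow> 'a) \<times> 'b) monoid"
    (infixr "\<wr>" 80)
  where "A \<wr> B =
    \<lparr>carrier = carrier (sum_group (carrier B) (\<lambda>_. A)) \<times> carrier B,
     monoid.mult = (\<lambda>(f, b) (f', b').
       (f \<otimes>\<^bsub>sum_group (carrier B) (\<lambda>_. A)\<^esub> left_translate B b f', b \<otimes>\<^bsub>B\<^esub> b')),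
     one = (\<one>\<^bsub>sum_group (carrier B) (\<lambda>_. A)\<^esub>, \<one>\<^bsub>B\<^esub>)\<rparr>"

lemma left_translate_closed:
  assumes "group A" "group B" "b \<in> carrier B" "f \<in> carrier (sum_group (carrier B) (\<lambda>_. A))"
  shows "left_translate B b f \<in> carrier (sum_group (carrier B) (\<lambda>_. A))"
proof -
  interpret B: group B by fact
  have f: "f \<in> carrier B \<rightarrow>\<^sub>E carrier A" "finite {i \<in> carrier B. f i \<noteq> \<one>\<^bsub>A\<^esub>}"
    using assms(4) by (auto simp: carrier_sum_group assms(1))
  have "{i \<in> carrier B. f (inv\<^bsub>B\<^esub> b \<otimes>\<^bsub>B\<^esub> i) \<noteq> \<one>\<^bsub>A\<^esub>}
      \<subseteq> (\<lambda>x. b \<otimes>\<^bsub>B\<^esub> x) ` {i \<in> carrier B. f i \<noteq> \<one>\<^bsub>A\<^esub>}"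
  proof
    fix i assume i: "i \<in> {i \<in> carrier B. f (inv\<^bsub>B\<^esub> b \<otimes>\<^bsub>B\<^esub> i) \<noteq> \<one>\<^bsub>A\<^esub>}"
    then have "i = b \<otimes>\<^bsub>B\<^esub> (inv\<^bsub>B\<^esub> b \<otimes>\<^bsub>B\<^esub> i)"
      using assms(3) by (simp add: B.m_assoc[symmetric])
    with i show "i \<in> (\<lambda>x. b \<otimes>\<^bsub>B\<^esub> x) ` {i \<in> carrier B. f i \<noteq> \<one>\<^bsub>A\<^esub>}"
      using assms(3) by blast
  qed
  then have "finite {i \<in> carrier B. f (inv\<^bsub>B\<^esub> b \<otimes>\<^bsub>B\<^esub> i) \<noteq> \<one>\<^bsub>A\<^esub>}"
    using f(2) by (meson finite_surj)
  then have "finite {i \<in> carrier B. left_translate B b f i \<noteq> \<one>\<^bsub>A\<^esub>}"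
    by (rule rev_finite_subset) (auto simp: left_translate_def)
  moreover have "left_translate B b f \<in> carrier B \<rightarrow>\<^sub>E carrier A"
    using f(1) assms(3) by (auto simp: left_translate_def PiE_iff)
  ultimately show ?thesis by (simp add: carrier_sum_group assms(1))
qed

lemma group_wreath:
  assumes "group A" "group B"
  shows "group (A \<wr> B)"
proof -
  interpret A: group A by fact
  interpret B: group B by fact
  let ?S = "sum_group (carrier B) (\<lambda>_. A)"
  interpret S: group ?S using assms(1) by simp
  have app: "f x \<in> carrier A" if "f \<in> carrier ?S" "x \<in> carrier B" for f x
    using that by (auto simp: carrier_sum_group assms(1))
  have ext: "f = (\<lambda>x\<in>carrier B. f x)" if "f \<in> carrier ?S" for f
    using that by (auto simp: carrier_sum_group assms(1) PiE_iff extensional_restrict)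
  have hom: "left_translate B b (f \<otimes>\<^bsub>?S\<^esub> g) = left_translate B b f \<otimes>\<^bsub>?S\<^esub> left_translate B b g"
    if "b \<in> carrier B" for b f g
    using that by (auto simp: left_translate_def intro!: restrict_ext)
  have act: "left_translate B b (left_translate B c f) = left_translate B (b \<otimes>\<^bsub>B\<^esub> c) f"
    if "b \<in> carrier B" "c \<in> carrier B" for b c f
    using that by (auto simp: left_translate_def B.inv_mult_group B.m_assoc intro!: restrict_ext)
  have act1: "left_translate B \<one>\<^bsub>B\<^esub> f = f" if "f \<in> carrier ?S" for f
    by (subst (2) ext[OF that]) (auto simp: left_translate_def intro!: restrict_ext)
  have hom1: "left_translate B b \<one>\<^bsub>?S\<^esub> = \<one>\<^bsub>?S\<^esub>" if "b \<in> carrier B" for b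
    using that by (auto simp: left_translate_def intro!: restrict_ext)
  note cl = left_translate_closed[OF assms]
  note [simp del] = mult_sum_group one_sum_group
  show ?thesis
  proof (rule groupI)
    show "x \<otimes>\<^bsub>A \<wr> B\<^esub> y \<in> carrier (A \<wr> B)"
      if "x \<in> carrier (A \<wr> B)" "y \<in> carrier (A \<wr> B)" for x y
      using that by (auto simp: wreath_def cl)
    show "\<one>\<^bsub>A \<wr> B\<^esub> \<in> carrier (A \<wr> B)"
      by (simp add: wreath_def)
    show "x \<otimes>\<^bsub>A \<wr> B\<^esub> y \<otimes>\<^bsub>A \<wr> B\<^esub> z = x \<otimes>\<^bsub>A \<wr> B\<^esub> (y \<otimes>\<^bsub>A \<wr> B\<^esub> z)"
      if "x \<in> carrier (A \<wr> B)" "y \<in> carrier (A \<wr> B)" "z \<in> carrier (A \<wr> B)" for x y z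
      using that by (auto simp: wreath_def cl hom act S.m_assoc B.m_assoc)
    show "\<one>\<^bsub>A \<wr> B\<^esub> \<otimes>\<^bsub>A \<wr> B\<^esub> x = x" if "x \<in> carrier (A \<wr> B)" for x
      using that by (auto simp: wreath_def act1)
    show "\<exists>y\<in>carrier (A \<wr> B). y \<otimes>\<^bsub>A \<wr> B\<^esub> x = \<one>\<^bsub>A \<wr> B\<^esub>" if x: "x \<in> carrier (A \<wr> B)" for x
    proof -
      obtain f b where fb: "x = (f, b)" "f \<in> carrier ?S" "b \<in> carrier B"
        using x by (auto simp: wreath_def)
      let ?y = "(inv\<^bsub>?S\<^esub> left_translate B (inv\<^bsub>B\<^esub> b) f, inv\<^bsub>B\<^esub> b)"
      have "?y \<in> carrier (A \<wr> B)" "?y \<otimes>\<^bsub>A \<wr> B\<^esub> x = \<one>\<^bsub>A \<wr> B\<^esub>"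
        using fb by (simp_all add: wreath_def cl del: inv_sum_group)
      then show ?thesis by blast
    qed
  qed
qed

context extension_closed_pseudovariety
begin

lemma in_class_Mod_kernel:
  assumes "group G" "in_class \<C> K" "h \<in> hom G K"
  shows "in_class \<C> (G Mod kernel G K h)"
proof -
  obtain H \<phi> where H: "H \<in> \<C>" and \<phi>: "\<phi> \<in> iso K H"
    using assms(2) by (auto simp: in_class_def is_iso_def)
  have K: "group K" using assms(2) by (simp add: in_class_def)
  have gH: "group H" using finite_groups[OF H] by simp
  interpret H: group H by fact
  define k where "k = \<phi> \<circ> h"
  have k: "k \<in> hom G H"
    using assms(3) \<phi> by (auto simp: k_def iso_def intro: hom_compose)
  interpret gh: group_hom G H k
    using assms(1) gH k by (simp add: group_hom_def group_hom_axioms_def)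
  interpret pk: group_hom K H \<phi>
    using K gH \<phi> by (simp add: group_hom_def group_hom_axioms_def iso_def)
  have inj: "inj_on \<phi> (carrier K)" using \<phi> by (simp add: iso_def bij_betw_def)
  have "\<phi> y = \<one>\<^bsub>H\<^esub> \<longleftrightarrow> y = \<one>\<^bsub>K\<^esub>" if "y \<in> carrier K" for y
    using inj_onD[OF inj, of y "\<one>\<^bsub>K\<^esub>"] that pk.hom_one pk.one_closed by auto
  then have ker: "kernel G K h = kernel G H k"
    using hom_in_carrier[OF assms(3)] by (auto simp: kernel_def k_def)
  let ?I = "k ` carrier G"
  have sub: "subgroup ?I H" by (rule gh.img_is_subgroup)
  let ?HI = "H\<lparr>carrier := ?I\<rparr>"
  interpret im: group_hom G ?HI k
    using assms(1) H.subgroup_imp_group[OF sub] k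
    by (simp add: group_hom_def group_hom_axioms_def hom_def)
  have "kernel G ?HI k = kernel G H k" by (simp add: kernel_def)
  then have "G Mod kernel G H k \<cong> ?HI" using im.FactGroup_iso by simp
  moreover obtain L where "L \<in> \<C>" "?HI \<cong> L"
    using subgroup_closed[OF H sub] by (auto simp: in_class_def)
  ultimately have "\<exists>L\<in>\<C>. G Mod kernel G H k \<cong> L" using iso_trans by blast
  then show ?thesis
    using normal.factorgroup_is_group[OF gh.normal_kernel] by (simp add: in_class_def ker)
qed

lemma in_class_Mod_Int:
  assumes "group G" "N \<lhd> G" "M \<lhd> G" "in_class \<C> (G Mod N)" "in_class \<C> (G Mod M)"
  shows "in_class \<C> (G Mod (N \<inter> M))"
proof -
  have aux: "\<exists>H\<in>\<C>. \<exists>h\<in>hom G H. kernel G H h = N'"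
    if N': "N' \<lhd> G" and c: "in_class \<C> (G Mod N')" for N'
  proof -
    obtain H \<phi> where H: "H \<in> \<C>" and \<phi>: "\<phi> \<in> iso (G Mod N') H"
      using c by (auto simp: in_class_def is_iso_def)
    have gH: "group H" using finite_groups[OF H] by simp
    interpret N': normal N' G by fact
    interpret p: group_hom "G Mod N'" H \<phi>
      using N'.factorgroup_is_group gH \<phi> by (simp add: group_hom_def group_hom_axioms_def iso_def)
    have h: "\<phi> \<circ> (\<lambda>x. N' #>\<^bsub>G\<^esub> x) \<in> hom G H"
      using N'.r_coset_hom_Mod p.homh by (rule hom_compose)
    have inj: "inj_on \<phi> (carrier (G Mod N'))" using \<phi> by (simp add: iso_def bij_betw_def)
    have "\<phi> (N' #>\<^bsub>G\<^esub> x) = \<one>\<^bsub>H\<^esub> \<longleftrightarrow> x \<in> N'" if x: "x \<in> carrier G" for x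
    proof -
      have "\<phi> (N' #>\<^bsub>G\<^esub> x) = \<one>\<^bsub>H\<^esub> \<longleftrightarrow> N' #>\<^bsub>G\<^esub> x = N'"
        using inj_on_eq_iff[OF inj, of "N' #>\<^bsub>G\<^esub> x" N'] x p.hom_one
          p.G.one_closed imageI[OF x, of "\<lambda>x. N' #>\<^bsub>G\<^esub> x"]
        unfolding carrier_FactGroup one_FactGroup by metis
      also have "\<dots> \<longleftrightarrow> x \<in> N'"
        using x N'.rcos_self N'.rcos_const N'.is_subgroup by (metis N'.coset_join1 N'.coset_join2 N'.subset)
      finally show ?thesis .
    qed
    then have "kernel G H (\<phi> \<circ> (\<lambda>x. N' #>\<^bsub>G\<^esub> x)) = N'"
      using N'.subset by (auto simp: kernel_def)
    with H h show ?thesis by blast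
  qed
  obtain H h where H: "H \<in> \<C>" "h \<in> hom G H" "kernel G H h = N"
    using aux[OF assms(2,4)] by blast
  obtain K k where K: "K \<in> \<C>" "k \<in> hom G K" "kernel G K k = M"
    using aux[OF assms(3,5)] by blast
  let ?f = "\<lambda>x. (h x, k x)"
  have "?f \<in> hom G (H \<times>\<times> K)"
    using H(2) K(2) by (auto simp: hom_def)
  moreover have "kernel G (H \<times>\<times> K) ?f = N \<inter> M"
    using H(3) K(3) by (auto simp: kernel_def)
  ultimately show ?thesis
    using in_class_Mod_kernel[OF assms(1) product_closed[OF H(1) K(1)], of ?f] by simp
qed

lemma in_class_Mod_carrier:
  assumes "group G"
  shows "in_class \<C> (G Mod carrier G)"
proof -
  obtain H where H: "H \<in> \<C>" using nonempty by blast
  then have gH: "group H" using finite_groups by blast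
  have "in_class \<C> H" using H gH by (auto simp: in_class_def intro: iso_refl)
  moreover have "(\<lambda>_. \<one>\<^bsub>H\<^esub>) \<in> hom G H"
    using gH by (auto simp: hom_def intro: monoid.l_one[symmetric] group.is_monoid monoid.one_closed)
  moreover have "kernel G H (\<lambda>_. \<one>\<^bsub>H\<^esub>) = carrier G" by (auto simp: kernel_def)
  ultimately show ?thesis using in_class_Mod_kernel[OF assms] by metis
qed

text \<open>The cosets form a base of a topology, so the junk value of \<^const>\<open>topology\<close> does not arise.\<close>

lemma openin_pro_topology:
  assumes "group G"
  shows "openin (pro_topology \<C> G) = arbitrary union_of (pro_base \<C> G)"
proof -
  interpret G: group G by fact
  have "(arbitrary union_of (pro_base \<C> G)) (S \<inter> T)"
    if S: "pro_base \<C> G S" and T: "pro_base \<C> G T" for S T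
  proof -
    obtain g N where g: "g \<in> carrier G" "N \<lhd> G" "in_class \<C> (G Mod N)" "S = g <#\<^bsub>G\<^esub> N"
      using S by (auto simp: pro_base_def)
    obtain h M where h: "h \<in> carrier G" "M \<lhd> G" "in_class \<C> (G Mod M)" "T = h <#\<^bsub>G\<^esub> M"
      using T by (auto simp: pro_base_def)
    have sg: "subgroup N G" "subgroup M G"
      using g h normal_imp_subgroup by blast+
    have "\<exists>V. pro_base \<C> G V \<and> x \<in> V \<and> V \<subseteq> S \<inter> T" if x: "x \<in> S \<inter> T" for x
    proof -
      have xS: "x \<in> g <#\<^bsub>G\<^esub> N" and xT: "x \<in> h <#\<^bsub>G\<^esub> M" using x g h by auto
      have eq: "S = x <#\<^bsub>G\<^esub> N" "T = x <#\<^bsub>G\<^esub> M"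
        using G.l_repr_independence[OF xS g(1) sg(1)] G.l_repr_independence[OF xT h(1) sg(2)] g h by auto
      have xG: "x \<in> carrier G"
        using xS g(1) subgroup.subset[OF sg(1)] G.l_coset_subset_G by blast
      let ?V = "x <#\<^bsub>G\<^esub> (N \<inter> M)"
      have n: "N \<inter> M \<lhd> G"
        using G.normal_subgroup_intersect g(2) h(2) by blast
      have "pro_base \<C> G ?V"
        using xG n in_class_Mod_Int[OF assms g(2) h(2) g(3) h(3)] by (auto simp: pro_base_def)
      moreover have "x \<in> ?V"
        using xG subgroup.one_closed[OF normal_imp_subgroup[OF n]] by (force simp: l_coset_def)
      moreover have "?V \<subseteq> S \<inter> T" unfolding eq by (auto simp: l_coset_def)
      ultimately show ?thesis by blast
    qed
    then show ?thesis by (auto simp: arbitrary_union_of_alt)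
  qed
  then have "istopology (arbitrary union_of (pro_base \<C> G))"
    by (simp add: istopology_base_eq)
  then show ?thesis by (simp add: pro_topology_def topology_inverse')
qed

lemma topspace_pro_topology:
  assumes "group G"
  shows "topspace (pro_topology \<C> G) = carrier G"
proof -
  interpret G: group G by fact
  have sub: "U \<subseteq> carrier G" if "pro_base \<C> G U" for U
    using that by (metis G.l_coset_subset_G normal_imp_subgroup pro_base_def subgroup.subset)
  have "\<one>\<^bsub>G\<^esub> <#\<^bsub>G\<^esub> carrier G = carrier G" by (force simp: l_coset_def)
  then have "pro_base \<C> G (carrier G)"
    using in_class_Mod_carrier[OF assms] G.normal_self G.one_closed unfolding pro_base_def by metis
  then have "openin (pro_topology \<C> G) (carrier G)"
    by (simp add: openin_pro_topology[OF assms] union_of_inc arbitrary_def)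
  moreover have "topspace (pro_topology \<C> G) \<subseteq> carrier G"
    using openin_topspace[of "pro_topology \<C> G"] sub
    by (fastforce simp: openin_pro_topology[OF assms] union_of_def)
  ultimately show ?thesis using openin_subset by blast
qed

end

end

theory Submission
  imports Defs
begin

text \<open>
  \<open>G\<close> is \<open>\<C>\<close>-cyclic subgroup separable iff every \<open>h \<notin> \<langle>g\<rangle>\<close> can be kept out of \<open>\<langle>g\<rangle>\<close> by a homomorphism
  from \<open>G\<close> to a group in \<open>\<C>\<close>.

  Necessity: if \<open>B\<close> is not in \<open>\<C>\<close>, a homomorphism from \<open>A \<wr> B\<close> to a group in \<open>\<C>\<close> kills some \<open>b \<noteq> \<one>\<close>
  in \<open>B\<close>, hence identifies the copies of \<open>A\<close> at the coordinates \<open>\<one>\<close> and \<open>b\<close>.  These commute, so all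
  commutators of \<open>A\<close> at the coordinate \<open>\<one>\<close> are killed.

  Sufficiency: we may assume that \<open>h = (u, \<one>)\<close> lies in the base group.  If \<open>B\<close> is in \<open>\<C>\<close> and \<open>b\<close> is
  the \<open>B\<close>-component of \<open>g\<close>, of order \<open>n\<close>, it is enough to separate \<open>u\<close> from the powers of the base
  component \<open>F\<close> of \<open>g\<^sup>n\<close>, and this can be done coordinatewise by a homomorphism from \<open>A\<close> to some
  \<open>K \<in> \<C>\<close>, since \<open>K \<wr> B\<close> is in \<open>\<C>\<close>.  If \<open>A\<close> is abelian, a homomorphism \<open>\<beta>\<close> from \<open>B\<close> to \<open>Q \<in> \<C>\<close> induces one
  from \<open>A \<wr> B\<close> to \<open>A \<wr> Q\<close> which multiplies the values along the fibres of \<open>\<beta>\<close>, and a \<open>\<beta>\<close> that is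
  injective on a suitable finite set reduces the claim to the first case.
\<close>

section \<open>Permanence properties of the class\<close>

lemma hom_group_hom: "\<lbrakk>group G; group H; h \<in> hom G H\<rbrakk> \<Longrightarrow> group_hom G H h"
  by (simp add: group_hom_def group_hom_axioms_def)

text \<open>The members of \<open>\<C>\<close> live on \<open>nat\<close>, and
  \<open>extension_closed\<close> speaks of such groups only; a finite group is carried there along
  an injection of its carrier.\<close>

lemma exists_nat_copy:
  assumes "group G" "finite (carrier G)"
  shows "\<exists>H::nat monoid. group H \<and> G \<cong> H"
proof -
  interpret group G by fact
  obtain e :: "'a \<Rightarrow> nat" where e: "inj_on e (carrier G)"
    using finite_imp_inj_to_nat_seg[OF assms(2)] by blast
  let ?H = "image_group e G"
  have h: "e \<in> iso G ?H"
    using e by (auto simp: iso_iff image_group_def hom_def)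
  have "group (?H\<lparr>one := e \<one>\<^bsub>G\<^esub>\<rparr>)"
    by (rule iso_imp_img_group[OF h])
  then have "group ?H" by (simp add: image_group_def)
  with h show ?thesis by (auto simp: is_iso_def)
qed

context extension_closed_pseudovariety
begin

lemma in_class_member: "K \<in> \<C> \<Longrightarrow> in_class \<C> K"
  using finite_groups iso_refl unfolding in_class_def by blast

lemma in_class_group: "in_class \<C> G \<Longrightarrow> group G"
  by (simp add: in_class_def)

lemma in_class_finite:
  assumes "in_class \<C> G"
  shows "finite (carrier G)"
proof -
  obtain K \<phi> where "K \<in> \<C>" "\<phi> \<in> iso G K"
    using assms by (auto simp: in_class_def is_iso_def)
  then show ?thesis
    using finite_groups bij_betw_finite by (auto simp: iso_def)
qed

text \<open>The domain is isomorphic to its image inside a member of \<open>\<C>\<close>; this is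
  closure under subgroups for groups over any type.\<close>

lemma in_class_embed:
  assumes "group G" "in_class \<C> H" "\<phi> \<in> hom G H" "inj_on \<phi> (carrier G)"
  shows "in_class \<C> G"
proof -
  obtain K \<psi> where K: "K \<in> \<C>" "\<psi> \<in> iso H K"
    using assms(2) by (auto simp: in_class_def is_iso_def)
  interpret h: group_hom G K "\<psi> \<circ> \<phi>"
    using K assms finite_groups by (auto intro!: hom_group_hom hom_compose simp: iso_def)
  have "inj_on (\<psi> \<circ> \<phi>) (carrier G)"
    using K(2) assms by (auto intro!: comp_inj_on inj_on_subset[of \<psi> "carrier H"]
        simp: iso_iff hom_in_carrier)
  then have "\<psi> \<circ> \<phi> \<in> iso G (K\<lparr>carrier := (\<psi> \<circ> \<phi>) ` carrier G\<rparr>)"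
    using h.homh by (auto simp: iso_iff hom_def)
  moreover obtain L where "L \<in> \<C>" "K\<lparr>carrier := (\<psi> \<circ> \<phi>) ` carrier G\<rparr> \<cong> L"
    using subgroup_closed[OF K(1) h.img_is_subgroup] by (auto simp: in_class_def)
  ultimately show ?thesis
    using assms(1) iso_trans is_isoI unfolding in_class_def by blast
qed

lemma in_class_iso: "\<lbrakk>in_class \<C> H; group G; G \<cong> H\<rbrakk> \<Longrightarrow> in_class \<C> G"
  unfolding in_class_def using iso_trans by blast

lemma in_class_DirProd:
  assumes "in_class \<C> G" "in_class \<C> H"
  shows "in_class \<C> (G \<times>\<times> H)"
proof -
  obtain K \<phi> where K: "K \<in> \<C>" "\<phi> \<in> iso G K"
    using assms(1) by (auto simp: in_class_def is_iso_def)
  obtain L \<psi> where L: "L \<in> \<C>" "\<psi> \<in> iso H L"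
    using assms(2) by (auto simp: in_class_def is_iso_def)
  show ?thesis
  proof (rule in_class_embed[OF _ product_closed[OF K(1) L(1)]])
    show "group (G \<times>\<times> H)"
      using assms by (simp add: DirProd_group in_class_group)
    show "(\<lambda>(x, y). (\<phi> x, \<psi> y)) \<in> hom (G \<times>\<times> H) (K \<times>\<times> L)"
      using K L by (auto simp: hom_def iso_def)
    show "inj_on (\<lambda>(x, y). (\<phi> x, \<psi> y)) (carrier (G \<times>\<times> H))"
      using K L by (auto simp: inj_on_def iso_iff)
  qed
qed

text \<open>To apply \<open>extension_closed\<close>, \<open>G\<close> is replaced by a copy on
  \<open>nat\<close>. This requires \<open>G\<close> to be finite: it is covered by finitely many
  fibres of \<open>\<pi>\<close>, each a coset of the finite kernel.\<close>

lemma in_class_extension: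
  assumes G: "group G" and \<pi>: "\<pi> \<in> hom G Q" and Q: "in_class \<C> Q"
    and ker: "in_class \<C> (G\<lparr>carrier := kernel G Q \<pi>\<rparr>)"
  shows "in_class \<C> G"
proof -
  interpret \<pi>: group_hom G Q \<pi>
    by (rule hom_group_hom[OF G in_class_group[OF Q] \<pi>])
  have "finite (\<pi> ` carrier G)"
    using in_class_finite[OF Q] by (rule finite_subset[rotated]) auto
  moreover have "finite (\<pi> -` {y} \<inter> carrier G)" if "y \<in> \<pi> ` carrier G" for y
  proof -
    obtain z where z: "z \<in> carrier G" "y = \<pi> z" using \<open>y \<in> \<pi> ` carrier G\<close> by blast
    have "\<pi> -` {y} \<inter> carrier G \<subseteq> (\<lambda>k. k \<otimes>\<^bsub>G\<^esub> z) ` kernel G Q \<pi>"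
    proof
      fix x assume x: "x \<in> \<pi> -` {y} \<inter> carrier G"
      then have "x \<otimes>\<^bsub>G\<^esub> inv\<^bsub>G\<^esub> z \<in> kernel G Q \<pi>" "x = x \<otimes>\<^bsub>G\<^esub> inv\<^bsub>G\<^esub> z \<otimes>\<^bsub>G\<^esub> z"
        using z by (auto simp: kernel_def \<pi>.G.m_assoc)
      then show "x \<in> (\<lambda>k. k \<otimes>\<^bsub>G\<^esub> z) ` kernel G Q \<pi>" by blast
    qed
    then show ?thesis
      using in_class_finite[OF ker] by (auto elim!: finite_subset)
  qed
  ultimately have "finite (carrier G)" using inf_img_fin_dom' by metis
  then obtain H :: "nat monoid" and \<theta> where H: "group H" "\<theta> \<in> iso H G"
    using exists_nat_copy[OF G] \<pi>.G.iso_set_sym unfolding is_iso_def by blast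
  let ?\<rho> = "\<pi> \<circ> \<theta>"
  have \<rho>: "?\<rho> \<in> hom H Q"
    using H \<pi> by (auto intro: hom_compose simp: iso_def)
  interpret \<rho>: group_hom H Q ?\<rho>
    by (rule hom_group_hom[OF H(1) in_class_group[OF Q] \<rho>])
  have "in_class \<C> (H\<lparr>carrier := kernel H Q ?\<rho>\<rparr>)"
  proof (rule in_class_embed[OF _ ker])
    show "group (H\<lparr>carrier := kernel H Q ?\<rho>\<rparr>)"
      using \<rho>.subgroup_kernel \<rho>.subgroup_imp_group by blast
    show "\<theta> \<in> hom (H\<lparr>carrier := kernel H Q ?\<rho>\<rparr>) (G\<lparr>carrier := kernel G Q \<pi>\<rparr>)"
      using H(2) by (auto simp: iso_def hom_def kernel_def)
    show "inj_on \<theta> (carrier (H\<lparr>carrier := kernel H Q ?\<rho>\<rparr>))"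
      using H(2) by (auto simp: iso_iff kernel_def inj_on_def)
  qed
  then have "H \<in> \<C>"
    using extension_closed[OF H(1) \<rho>.normal_kernel] in_class_Mod_kernel[OF H(1) Q \<rho>] by blast
  then show ?thesis
    using in_class_iso[OF in_class_member G] group.iso_sym[OF H(1)] is_isoI[OF H(2)] by blast
qed

text \<open>Splitting off the coordinate \<open>i\<close> embeds the sum into the direct product of
  \<open>K\<close> with a sum over fewer indices.\<close>

lemma in_class_sum_group:
  assumes "finite I" "in_class \<C> K"
  shows "in_class \<C> (sum_group I (\<lambda>_. K))"
  using assms(1)
proof (induction I rule: finite_induct)
  case empty
  have K: "group K" using assms(2) by (rule in_class_group)
  show ?case
    by (rule in_class_embed[OF _ assms(2), of _ "\<lambda>_. \<one>\<^bsub>K\<^esub>"])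
      (use K in \<open>auto simp: hom_def carrier_sum_group group.is_monoid\<close>)
next
  case (insert i I)
  have K: "group K" using assms(2) by (rule in_class_group)
  show ?case
  proof (rule in_class_embed[OF _ in_class_DirProd[OF assms(2) insert.IH]])
    let ?\<phi> = "\<lambda>f. (f i, restrict f I)"
    show "?\<phi> \<in> hom (sum_group (insert i I) (\<lambda>_. K)) (K \<times>\<times> sum_group I (\<lambda>_. K))"
      using K insert.hyps by (auto simp: hom_def carrier_sum_group PiE_iff intro!: restrict_ext)
    show "inj_on ?\<phi> (carrier (sum_group (insert i I) (\<lambda>_. K)))"
    proof (rule inj_onI)
      fix f g
      assume f: "f \<in> carrier (sum_group (insert i I) (\<lambda>_. K))"
        and g: "g \<in> carrier (sum_group (insert i I) (\<lambda>_. K))" and eq: "?\<phi> f = ?\<phi> g"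
      have "f x = g x" if "x \<in> insert i I" for x
        using eq that by (auto simp: restrict_def fun_eq_iff split: if_splits)
      then show "f = g"
        using f g K by (auto simp: carrier_sum_group PiE_iff intro: extensionalityI)
    qed
  qed (use K in simp)
qed

section \<open>Separation by homomorphisms\<close>

text \<open>A basic neighbourhood of \<open>h\<close> that avoids the cyclic subgroup is a coset of
  some \<open>N\<close>, and the quotient by \<open>N\<close>, copied into \<open>\<C>\<close>,
  separates. Conversely, the coset of \<open>h\<close> modulo the kernel of a separating
  homomorphism avoids the subgroup.\<close>

lemma cyclic_subgroup_separable_iff:
  assumes "group G"
  shows "cyclic_subgroup_separable \<C> G \<longleftrightarrow>
    (\<forall>g\<in>carrier G. \<forall>h\<in>carrier G. (\<forall>k::int. h \<noteq> g [^]\<^bsub>G\<^esub> k) \<longrightarrow>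
      (\<exists>K\<in>\<C>. \<exists>\<phi>\<in>hom G K. \<forall>k::int. \<phi> h \<noteq> \<phi> g [^]\<^bsub>K\<^esub> k))"
    (is "_ \<longleftrightarrow> ?R")
proof -
  interpret G: group G by fact
  note top = topspace_pro_topology[OF assms] openin_pro_topology[OF assms]
  show ?thesis
  proof
    assume css: "cyclic_subgroup_separable \<C> G"
    show ?R
    proof (intro ballI impI)
      fix g h
      assume g: "g \<in> carrier G" and h: "h \<in> carrier G" and gh: "\<forall>k::int. h \<noteq> g [^]\<^bsub>G\<^esub> k"
      have "openin (pro_topology \<C> G) (carrier G - generate G {g})"
        using css g by (simp add: cyclic_subgroup_separable_def closedin_def top)
      moreover have "h \<in> carrier G - generate G {g}"
        using h gh g by (auto simp: G.generate_pow)
      ultimately obtain U where U: "pro_base \<C> G U" "h \<in> U" "U \<subseteq> carrier G - generate G {g}"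
        unfolding top by (auto simp: arbitrary_union_of_alt)
      then obtain x N where N: "x \<in> carrier G" "N \<lhd> G" "in_class \<C> (G Mod N)" "U = x <#\<^bsub>G\<^esub> N"
        by (auto simp: pro_base_def)
      interpret N: normal N G by fact
      \<comment> \<open>Any element of a coset represents it, so \<open>U\<close> can be centred at
        \<open>h\<close>.\<close>
      have hN: "U = h <#\<^bsub>G\<^esub> N"
        using G.l_repr_independence[of h x N] U(2) N N.is_subgroup by simp
      obtain K \<psi> where K: "K \<in> \<C>" "\<psi> \<in> iso (G Mod N) K"
        using N(3) by (auto simp: in_class_def is_iso_def)
      interpret K: group K using K finite_groups by blast
      let ?\<phi> = "\<psi> \<circ> (\<lambda>x. N #>\<^bsub>G\<^esub> x)"
      have \<phi>: "?\<phi> \<in> hom G K"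
        using N.r_coset_hom_Mod K(2) by (auto intro: hom_compose simp: iso_def)
      interpret \<phi>: group_hom G K ?\<phi> using \<phi> by (intro hom_group_hom) auto
      have "?\<phi> h \<noteq> ?\<phi> g [^]\<^bsub>K\<^esub> k" for k :: int
      proof
        assume "?\<phi> h = ?\<phi> g [^]\<^bsub>K\<^esub> k"
        then have "\<psi> (N #>\<^bsub>G\<^esub> h) = \<psi> (N #>\<^bsub>G\<^esub> (g [^]\<^bsub>G\<^esub> k))"
          using \<phi>.hom_int_pow[OF g, of k] by simp
        then have "N #>\<^bsub>G\<^esub> h = N #>\<^bsub>G\<^esub> (g [^]\<^bsub>G\<^esub> k)"
          using inj_onD[of \<psi> "carrier (G Mod N)" "N #>\<^bsub>G\<^esub> h" "N #>\<^bsub>G\<^esub> (g [^]\<^bsub>G\<^esub> k)"] K(2)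
            imageI[OF h, of "r_coset G N"] imageI[OF G.int_pow_closed[OF g], of "r_coset G N" k]
          unfolding iso_iff carrier_FactGroup by blast
        then have "g [^]\<^bsub>G\<^esub> k \<in> N #>\<^bsub>G\<^esub> h"
          using g G.rcos_self[OF _ N.is_subgroup] by simp
        \<comment> \<open>Normality of \<open>N\<close> turns the right coset coming from the
          quotient map into the left coset \<open>U\<close>.\<close>
        then have "g [^]\<^bsub>G\<^esub> k \<in> U" using N.coset_eq h hN by auto
        then show False using U(3) g by (auto simp: G.generate_pow)
      qed
      then show "\<exists>K\<in>\<C>. \<exists>\<phi>\<in>hom G K. \<forall>k::int. \<phi> h \<noteq> \<phi> g [^]\<^bsub>K\<^esub> k"
        using K(1) \<phi> by blast
    qed
  next
    assume R: ?R
    show "cyclic_subgroup_separable \<C> G"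
      unfolding cyclic_subgroup_separable_def
    proof
      fix g assume g: "g \<in> carrier G"
      have sub: "generate G {g} \<subseteq> carrier G"
        using g by (auto simp: G.generate_pow)
      have "\<exists>U. pro_base \<C> G U \<and> h \<in> U \<and> U \<subseteq> carrier G - generate G {g}"
        if h: "h \<in> carrier G - generate G {g}" for h
      proof -
        have "\<forall>k::int. h \<noteq> g [^]\<^bsub>G\<^esub> k"
          using h g by (auto simp: G.generate_pow)
        then obtain K \<phi> where K: "K \<in> \<C>" "\<phi> \<in> hom G K" "\<forall>k::int. \<phi> h \<noteq> \<phi> g [^]\<^bsub>K\<^esub> k"
          using R g h by blast
        interpret K: group K using K finite_groups by blast
        interpret \<phi>: group_hom G K \<phi> using K by (intro hom_group_hom) auto
        let ?U = "h <#\<^bsub>G\<^esub> kernel G K \<phi>"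
        have "pro_base \<C> G ?U"
          using h \<phi>.normal_kernel in_class_Mod_kernel[OF assms in_class_member[OF K(1)] K(2)]
          by (auto simp: pro_base_def)
        moreover have "h \<in> ?U"
          using h by (force simp: l_coset_def kernel_def)
        moreover have "?U \<subseteq> carrier G - generate G {g}"
        proof
          fix u assume "u \<in> ?U"
          then obtain n where n: "n \<in> carrier G" "\<phi> n = \<one>\<^bsub>K\<^esub>" "u = h \<otimes>\<^bsub>G\<^esub> n"
            by (auto simp: l_coset_def kernel_def)
          then have "\<phi> u = \<phi> h" "u \<in> carrier G" using h by auto
          then show "u \<in> carrier G - generate G {g}"
            using K(3)[rule_format, symmetric] g \<phi>.hom_int_pow[OF g] by (auto simp: G.generate_pow)
        qed
        ultimately show ?thesis by blast
      qed
      then have "openin (pro_topology \<C> G) (carrier G - generate G {g})"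
        unfolding top by (auto simp: arbitrary_union_of_alt)
      then show "closedin (pro_topology \<C> G) (generate G {g})"
        using sub by (simp add: closedin_def top)
    qed
  qed
qed

end

section \<open>Systems of congruences over the integers\<close>

text \<open>Chinese remainder theorem for moduli that need not be coprime: Bezout coefficients write
  \<open>i - j\<close> as a combination of \<open>p\<close> and \<open>q\<close>, and subtracting
  its \<open>p\<close>-part from \<open>i\<close> gives the solution.\<close>

lemma int_common_solution:
  fixes p q i j :: int
  assumes "gcd p q dvd i - j"
  shows "\<exists>n. p dvd n - i \<and> q dvd n - j"
proof -
  obtain u v where "u * p + v * q = gcd p q" using bezout_int by blast
  moreover obtain t where t: "i - j = gcd p q * t" using assms by blast
  ultimately have "i - j = (u * p + v * q) * t" by simp
  then have "i - t * u * p - j = q * (v * t)" by (simp add: algebra_simps)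
  then have "p dvd (i - t * u * p) - i" "q dvd (i - t * u * p) - j" by simp_all
  then show ?thesis by blast
qed

text \<open>In the divisibility order \<open>gcd\<close> distributes over \<open>lcm\<close>. This
  lets congruences that are already solved be merged into a single one, whose modulus is their least
  common multiple.\<close>

lemma gcd_Lcm_dvd:
  fixes r :: "'x \<Rightarrow> int"
  assumes "finite S" "\<And>x. x \<in> S \<Longrightarrow> gcd (r x) c dvd d"
  shows "gcd (Lcm (r ` S)) c dvd d"
  using assms
proof (induction S rule: finite_induct)
  case (insert x S)
  have "gcd (Lcm (r ` insert x S)) c = gcd c (lcm (r x) (Lcm (r ` S)))"
    by (simp add: gcd.commute)
  also have "\<dots> = lcm (gcd c (r x)) (gcd c (Lcm (r ` S)))"
    by (rule gcd_lcm_distrib)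
  also have "\<dots> dvd d"
    using insert by (auto intro!: lcm_least simp: gcd.commute)
  finally show ?case .
qed simp

text \<open>A modulus may be \<open>0\<close>: it then stands for an equation between integers.\<close>

lemma int_common_solution_finite:
  fixes r i :: "'x \<Rightarrow> int"
  assumes "finite S" "\<And>x y. \<lbrakk>x \<in> S; y \<in> S\<rbrakk> \<Longrightarrow> gcd (r x) (r y) dvd i x - i y"
  shows "\<exists>n. \<forall>x\<in>S. r x dvd n - i x"
  using assms
proof (induction S rule: finite_induct)
  case (insert y S)
  then obtain n where n: "\<And>x. x \<in> S \<Longrightarrow> r x dvd n - i x" by auto
  \<comment> \<open>The solution \<open>n\<close> for \<open>S\<close> may be shifted by multiples
    of the \<open>Lcm\<close>, so it remains to check that its class modulo the \<open>Lcm\<close>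
    is compatible with the congruence for \<open>y\<close>.\<close>
  have "gcd (r x) (r y) dvd n - i y" if "x \<in> S" for x
  proof -
    have "gcd (r x) (r y) dvd (n - i x) + (i x - i y)"
      using n[OF that] insert.prems[of x y] that by (meson dvd_add dvd_trans gcd_dvd1 insertCI)
    then show ?thesis by simp
  qed
  then have "gcd (Lcm (r ` S)) (r y) dvd n - i y"
    by (rule gcd_Lcm_dvd[OF insert.hyps(1)])
  then obtain n' where n': "Lcm (r ` S) dvd n' - n" "r y dvd n' - i y"
    using int_common_solution by blast
  have "r x dvd n' - i x" if "x \<in> S" for x
  proof -
    have "r x dvd (n' - n) + (n - i x)"
      using n[OF that] n'(1) that by (meson dvd_add dvd_Lcm dvd_trans imageI)
    then show ?thesis by simp
  qed
  then show ?case using n'(2) by blast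
qed simp

context extension_closed_pseudovariety
begin

section \<open>Separation in finite families\<close>

lemma in_class_imp_cyclic_subgroup_separable:
  assumes "in_class \<C> G"
  shows "cyclic_subgroup_separable \<C> G"
proof -
  have G: "group G" using assms by (rule in_class_group)
  obtain K \<phi> where K: "K \<in> \<C>" "\<phi> \<in> iso G K"
    using assms by (auto simp: in_class_def is_iso_def)
  interpret \<phi>: group_hom G K \<phi>
    using K G finite_groups by (intro hom_group_hom) (auto simp: iso_def)
  have "\<phi> h \<noteq> \<phi> g [^]\<^bsub>K\<^esub> k"
    if "g \<in> carrier G" "h \<in> carrier G" "\<forall>k::int. h \<noteq> g [^]\<^bsub>G\<^esub> k" for g h and k :: int
  proof -
    have "\<phi> h \<noteq> \<phi> (g [^]\<^bsub>G\<^esub> k)"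
      using that K(2) by (auto simp: iso_iff dest!: inj_onD)
    then show ?thesis using that \<phi>.hom_int_pow by simp
  qed
  then show ?thesis
    using K(1) \<phi>.homh unfolding cyclic_subgroup_separable_iff[OF G] by blast
qed

text \<open>Composition allows separation to be checked in a separable image, which may itself be
  infinite, such as a wreath product of \<open>A\<close> with a finite group.\<close>

lemma separation_via_hom:
  assumes G: "group G" and Q: "group Q" "cyclic_subgroup_separable \<C> Q" and \<phi>: "\<phi> \<in> hom G Q"
    and gh: "g \<in> carrier G" "h \<in> carrier G" "\<And>k::int. \<phi> h \<noteq> \<phi> g [^]\<^bsub>Q\<^esub> k"
  shows "\<exists>K\<in>\<C>. \<exists>\<psi>\<in>hom G K. \<forall>k::int. \<psi> h \<noteq> \<psi> g [^]\<^bsub>K\<^esub> k"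
proof -
  obtain K \<psi> where K: "K \<in> \<C>" "\<psi> \<in> hom Q K" "\<forall>k::int. \<psi> (\<phi> h) \<noteq> \<psi> (\<phi> g) [^]\<^bsub>K\<^esub> k"
    using Q(2) gh hom_in_carrier[OF \<phi>] unfolding cyclic_subgroup_separable_iff[OF Q(1)] by blast
  have "\<psi> \<circ> \<phi> \<in> hom G K" using \<phi> K(2) by (rule hom_compose)
  then show ?thesis using K by (intro bexI[of _ K] bexI[of _ "\<psi> \<circ> \<phi>"]) auto
qed

text \<open>\<open>M\<close> is a copy of \<open>K \<times>\<times> L\<close> in
  \<open>\<C>\<close>, and \<open>p\<close>, \<open>q\<close> are the projections. Since they
  recover \<open>\<phi>\<close> and \<open>\<psi>\<close>, whatever either of these separates is
  separated by \<open>\<theta>\<close>.\<close>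

lemma exists_common_refinement:
  assumes G: "group G" and K: "K \<in> \<C>" "\<phi> \<in> hom G K" and L: "L \<in> \<C>" "\<psi> \<in> hom G L"
  shows "\<exists>M\<in>\<C>. \<exists>\<theta>\<in>hom G M. \<exists>p\<in>hom M K. \<exists>q\<in>hom M L.
    \<forall>x\<in>carrier G. p (\<theta> x) = \<phi> x \<and> q (\<theta> x) = \<psi> x"
proof -
  have gr: "group K" "group L" using K L finite_groups by auto
  obtain M \<iota> where M: "M \<in> \<C>" "\<iota> \<in> iso (K \<times>\<times> L) M"
    using product_closed[OF K(1) L(1)] by (auto simp: in_class_def is_iso_def)
  let ?\<kappa> = "inv_into (carrier (K \<times>\<times> L)) \<iota>"
  have \<kappa>: "?\<kappa> \<in> hom M (K \<times>\<times> L)"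
    using group.iso_set_sym[OF DirProd_group[OF gr] M(2)] by (simp add: iso_def)
  have pair: "(\<lambda>x. (\<phi> x, \<psi> x)) \<in> hom G (K \<times>\<times> L)"
    using K L by (auto simp: hom_def)
  have "fst \<in> hom (K \<times>\<times> L) K" "snd \<in> hom (K \<times>\<times> L) L" by (auto simp: hom_def)
  then have pq: "fst \<circ> ?\<kappa> \<in> hom M K" "snd \<circ> ?\<kappa> \<in> hom M L"
    using \<kappa> by (auto intro: hom_compose)
  have \<theta>: "\<iota> \<circ> (\<lambda>x. (\<phi> x, \<psi> x)) \<in> hom G M"
    using pair M(2) by (auto intro: hom_compose simp: iso_def)
  have "?\<kappa> (\<iota> (\<phi> x, \<psi> x)) = (\<phi> x, \<psi> x)" if "x \<in> carrier G" for x
    using M(2) hom_in_carrier[OF pair that] by (auto simp: iso_iff inv_into_f_f)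
  then show ?thesis using M(1) \<theta> pq
    by (intro bexI[of _ M] bexI[of _ "\<iota> \<circ> (\<lambda>x. (\<phi> x, \<psi> x))"] bexI[of _ "fst \<circ> ?\<kappa>"] bexI[of _ "snd \<circ> ?\<kappa>"])
      auto
qed

text \<open>Indices are added one at a time; a common refinement inherits both separations, because
  an equation in \<open>M\<close> maps to equations in \<open>K\<close> and in
  \<open>L\<close>.\<close>

lemma separation_finite:
  assumes G: "group G" and css: "cyclic_subgroup_separable \<C> G" and I: "finite I"
    and gh: "\<And>i. i \<in> I \<Longrightarrow> g i \<in> carrier G" "\<And>i. i \<in> I \<Longrightarrow> h i \<in> carrier G"
      "\<And>i (k::int). i \<in> I \<Longrightarrow> h i \<noteq> g i [^]\<^bsub>G\<^esub> k"
  shows "\<exists>K\<in>\<C>. \<exists>\<phi>\<in>hom G K. \<forall>i\<in>I. \<forall>k::int. \<phi> (h i) \<noteq> \<phi> (g i) [^]\<^bsub>K\<^esub> k"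
  using I gh
proof (induction I rule: finite_induct)
  case empty
  obtain K where K: "K \<in> \<C>" using nonempty by blast
  then interpret K: group K using finite_groups by blast
  have "(\<lambda>_. \<one>\<^bsub>K\<^esub>) \<in> hom G K" by (auto simp: hom_def)
  then show ?case using K by blast
next
  case (insert i I)
  then obtain K \<phi> where K: "K \<in> \<C>" "\<phi> \<in> hom G K"
      "\<forall>i\<in>I. \<forall>k::int. \<phi> (h i) \<noteq> \<phi> (g i) [^]\<^bsub>K\<^esub> k"
    by auto
  obtain L \<psi> where L: "L \<in> \<C>" "\<psi> \<in> hom G L" "\<forall>k::int. \<psi> (h i) \<noteq> \<psi> (g i) [^]\<^bsub>L\<^esub> k"
    using css insert.prems unfolding cyclic_subgroup_separable_iff[OF G] by (meson insertI1)
  obtain M \<theta> p q where M: "M \<in> \<C>" "\<theta> \<in> hom G M" "p \<in> hom M K" "q \<in> hom M L"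
      and pq: "\<And>x. x \<in> carrier G \<Longrightarrow> p (\<theta> x) = \<phi> x" "\<And>x. x \<in> carrier G \<Longrightarrow> q (\<theta> x) = \<psi> x"
    using exists_common_refinement[OF G K(1,2) L(1,2)] by blast
  have gr: "group K" "group L" "group M" using K L M finite_groups by auto
  note pow = hom_int_pow[OF M(3) _ gr(3,1)] hom_int_pow[OF M(4) _ gr(3,2)]
  have "\<theta> (h j) \<noteq> \<theta> (g j) [^]\<^bsub>M\<^esub> k" if j: "j \<in> insert i I" for j and k :: int
  proof
    assume eq: "\<theta> (h j) = \<theta> (g j) [^]\<^bsub>M\<^esub> k"
    have gj: "g j \<in> carrier G" "h j \<in> carrier G" using insert.prems j by auto
    have "\<phi> (h j) = \<phi> (g j) [^]\<^bsub>K\<^esub> k" "\<psi> (h j) = \<psi> (g j) [^]\<^bsub>L\<^esub> k"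
      using arg_cong[OF eq, of p] arg_cong[OF eq, of q] gj pq pow hom_in_carrier[OF M(2)] by simp_all
    then show False using K(3) L(3) j by auto
  qed
  then show ?case using M(1,2) by blast
qed

text \<open>The trivial subgroup is cyclic, so for each of the finitely many pairs
  \<open>x \<noteq> y\<close> in \<open>S\<close> the quotient of \<open>x\<close> by
  \<open>y\<close> can be kept out of it.\<close>

lemma exists_hom_inj_on:
  assumes G: "group G" and css: "cyclic_subgroup_separable \<C> G"
    and S: "finite S" "S \<subseteq> carrier G"
  shows "\<exists>K\<in>\<C>. \<exists>\<phi>\<in>hom G K. inj_on \<phi> S"
proof -
  interpret G: group G by fact
  let ?I = "{(x, y) \<in> S \<times> S. x \<noteq> y}"
  have "finite ?I" using S(1) by (auto intro: finite_subset[of _ "S \<times> S"])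
  then have "\<exists>K\<in>\<C>. \<exists>\<phi>\<in>hom G K. \<forall>i\<in>?I. \<forall>k::int.
      \<phi> (fst i \<otimes>\<^bsub>G\<^esub> inv\<^bsub>G\<^esub> snd i) \<noteq> \<phi> \<one>\<^bsub>G\<^esub> [^]\<^bsub>K\<^esub> k"
    by (rule separation_finite[OF G css]) (use S G.inv_solve_right'[of "\<one>\<^bsub>G\<^esub>"] in \<open>auto simp: subset_iff\<close>)
  then obtain K \<phi> where K: "K \<in> \<C>" "\<phi> \<in> hom G K"
      "\<forall>i\<in>?I. \<forall>k::int. \<phi> (fst i \<otimes>\<^bsub>G\<^esub> inv\<^bsub>G\<^esub> snd i) \<noteq> \<phi> \<one>\<^bsub>G\<^esub> [^]\<^bsub>K\<^esub> k"
    by blast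
  interpret \<phi>: group_hom G K \<phi> using K finite_groups G by (intro hom_group_hom) auto
  have "inj_on \<phi> S"
  proof (rule inj_onI, rule ccontr)
    fix x y assume xy: "x \<in> S" "y \<in> S" "\<phi> x = \<phi> y" "x \<noteq> y"
    then have "\<phi> (x \<otimes>\<^bsub>G\<^esub> inv\<^bsub>G\<^esub> y) = \<phi> \<one>\<^bsub>G\<^esub> [^]\<^bsub>K\<^esub> (0::int)"
      using S(2) by (auto simp: subset_iff)
    then show False using K(3) xy by auto
  qed
  then show ?thesis using K by blast
qed

text \<open>As \<open>m\<close> divides the order of \<open>a\<close>, no power of \<open>a\<close>
  with exponent strictly between \<open>0\<close> and \<open>m\<close> is a power of the
  \<open>m\<close>-th power of \<open>a\<close>. Keeping these finitely many elements out makes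
  \<open>m\<close> divide the order of the image: a nonzero remainder of that order modulo
  \<open>m\<close> would be such an exponent.\<close>

lemma exists_hom_dvd_ord:
  assumes G: "group G" and css: "cyclic_subgroup_separable \<C> G"
    and a: "a \<in> carrier G" and m: "m > 0" "m dvd group.ord G a"
  shows "\<exists>K\<in>\<C>. \<exists>\<phi>\<in>hom G K. m dvd group.ord K (\<phi> a)"
proof -
  interpret G: group G by fact
  have "\<exists>K\<in>\<C>. \<exists>\<phi>\<in>hom G K. \<forall>j\<in>{1..<m}. \<forall>k::int.
      \<phi> (a [^]\<^bsub>G\<^esub> int j) \<noteq> \<phi> (a [^]\<^bsub>G\<^esub> int m) [^]\<^bsub>K\<^esub> k"
  proof (rule separation_finite[OF G css])
    fix j and k :: int assume j: "j \<in> {1..<m}"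
    show "a [^]\<^bsub>G\<^esub> int j \<noteq> (a [^]\<^bsub>G\<^esub> int m) [^]\<^bsub>G\<^esub> k"
    proof
      assume "a [^]\<^bsub>G\<^esub> int j = (a [^]\<^bsub>G\<^esub> int m) [^]\<^bsub>G\<^esub> k"
      then have "int (G.ord a) dvd int m * k - int j"
        using a by (simp add: G.int_pow_pow G.int_pow_eq)
      then have "int m dvd int m * k - int j" using m(2) by (meson dvd_trans of_nat_dvd_iff)
      then have "int m dvd int j" by (metis dvd_diff_right_iff dvd_triv_left)
      then show False using j by (auto dest!: zdvd_imp_le)
    qed
  qed (use a in auto)
  then obtain K \<phi> where K: "K \<in> \<C>" "\<phi> \<in> hom G K"
      and ne: "\<And>j k. j \<in> {1..<m} \<Longrightarrow> \<phi> (a [^]\<^bsub>G\<^esub> int j) \<noteq> \<phi> (a [^]\<^bsub>G\<^esub> int m) [^]\<^bsub>K\<^esub> (k::int)"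
    by blast
  interpret K: group K using K finite_groups by blast
  interpret \<phi>: group_hom G K \<phi> using K G by (intro hom_group_hom) auto
  let ?o = "K.ord (\<phi> a)"
  have "?o mod m = 0"
  proof (rule ccontr)
    assume "?o mod m \<noteq> 0"
    then have j: "?o mod m \<in> {1..<m}" using m(1) by auto
    have "int m * - int (?o div m) - int (?o mod m) = - int ?o"
      by (simp add: algebra_simps flip: of_nat_mult of_nat_add)
    then have "\<phi> a [^]\<^bsub>K\<^esub> int (?o mod m) = \<phi> a [^]\<^bsub>K\<^esub> (int m * - int (?o div m))"
      using a by (subst K.int_pow_eq) auto
    also have "\<dots> = (\<phi> a [^]\<^bsub>K\<^esub> int m) [^]\<^bsub>K\<^esub> (- int (?o div m))"
      using a by (subst K.int_pow_pow) auto
    finally show False using ne[OF j] \<phi>.hom_int_pow[OF a] by metis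
  qed
  then have "m dvd ?o" by auto
  then show ?thesis using K(1,2) by blast
qed

text \<open>If \<open>h x = f x ^ i x\<close> for all \<open>x\<close>, a common exponent is a solution of a system of congruences
  modulo the orders of the \<open>f x\<close>; if there is none, already two of the congruences are incompatible,
  and they remain so in a quotient in which the orders have a suitable common divisor.\<close>

lemma separation_family:
  fixes f h :: "'x \<Rightarrow> 'g" and G :: "('g, 'z) monoid_scheme"
  assumes G: "group G" and css: "cyclic_subgroup_separable \<C> G" and S: "finite S"
    and fh: "\<And>x. x \<in> S \<Longrightarrow> f x \<in> carrier G" "\<And>x. x \<in> S \<Longrightarrow> h x \<in> carrier G"
    and ne: "\<And>k::int. \<exists>x\<in>S. h x \<noteq> f x [^]\<^bsub>G\<^esub> k"
  shows "\<exists>K\<in>\<C>. \<exists>\<phi>\<in>hom G K. \<forall>k::int. \<exists>x\<in>S. \<phi> (h x) \<noteq> \<phi> (f x) [^]\<^bsub>K\<^esub> k"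
proof (cases "\<exists>x\<in>S. \<forall>k::int. h x \<noteq> f x [^]\<^bsub>G\<^esub> k")
  case True
  then show ?thesis using css fh unfolding cyclic_subgroup_separable_iff[OF G] by meson
next
  case False
  interpret G: group G by fact
  obtain i :: "'x \<Rightarrow> int" where i: "\<And>x. x \<in> S \<Longrightarrow> h x = f x [^]\<^bsub>G\<^esub> i x"
    using False by metis
  \<comment> \<open>Powers of \<open>f x\<close> agree iff the exponents agree modulo its order,
    where \<open>0\<close> stands for infinite order; a common \<open>n\<close> would thus be an
    exponent excluded by \<open>ne\<close>.\<close>
  have "\<nexists>n. \<forall>x\<in>S. int (G.ord (f x)) dvd n - i x"
    using i fh(1) ne G.int_pow_eq by metis
  then obtain x y where xy: "x \<in> S" "y \<in> S"
      "\<not> gcd (int (G.ord (f x))) (int (G.ord (f y))) dvd i x - i y"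
    using int_common_solution_finite[OF S, of "\<lambda>x. int (G.ord (f x))" i] by blast
  \<comment> \<open>The \<open>gcd\<close> is \<open>0\<close> exactly when both orders are
    infinite. Every positive number then divides them, and one exceeding the nonzero difference of
    the exponents does not divide that difference.\<close>
  define m where "m = (if gcd (G.ord (f x)) (G.ord (f y)) = 0
    then Suc (nat \<bar>i x - i y\<bar>) else gcd (G.ord (f x)) (G.ord (f y)))"
  have m: "m > 0" "m dvd G.ord (f x)" "m dvd G.ord (f y)" by (auto simp: m_def)
  have ndvd: "\<not> int m dvd i x - i y"
  proof (cases "gcd (G.ord (f x)) (G.ord (f y)) = 0")
    case True
    then have "i x - i y \<noteq> 0" using xy(3) by auto
    then show ?thesis using True dvd_imp_le_int[of "i x - i y" "int m"] by (auto simp: m_def)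
  next
    case False
    then show ?thesis using False xy(3) by (auto simp: m_def)
  qed
  obtain K \<phi> where K: "K \<in> \<C>" "\<phi> \<in> hom G K" "m dvd group.ord K (\<phi> (f x))"
    using exists_hom_dvd_ord[OF G css fh(1)[OF xy(1)] m(1,2)] by blast
  obtain L \<psi> where L: "L \<in> \<C>" "\<psi> \<in> hom G L" "m dvd group.ord L (\<psi> (f y))"
    using exists_hom_dvd_ord[OF G css fh(1)[OF xy(2)] m(1,3)] by blast
  obtain M \<theta> p q where M: "M \<in> \<C>" "\<theta> \<in> hom G M" "p \<in> hom M K" "q \<in> hom M L"
      and pq: "\<And>x. x \<in> carrier G \<Longrightarrow> p (\<theta> x) = \<phi> x" "\<And>x. x \<in> carrier G \<Longrightarrow> q (\<theta> x) = \<psi> x"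
    using exists_common_refinement[OF G K(1,2) L(1,2)] by blast
  have gr: "group K" "group L" "group M" using K L M finite_groups by auto
  note carr = fh(1)[OF xy(1)] fh(1)[OF xy(2)]
  have "\<exists>x\<in>S. \<theta> (h x) \<noteq> \<theta> (f x) [^]\<^bsub>M\<^esub> k" for k :: int
  proof (rule ccontr)
    assume "\<not> ?thesis"
    then have eq: "\<theta> (h x) = \<theta> (f x) [^]\<^bsub>M\<^esub> k" "\<theta> (h y) = \<theta> (f y) [^]\<^bsub>M\<^esub> k"
      using xy by auto
    have "p (\<theta> (h x)) = \<phi> (f x) [^]\<^bsub>K\<^esub> k" "q (\<theta> (h y)) = \<psi> (f y) [^]\<^bsub>L\<^esub> k"
      unfolding eq using hom_int_pow[OF M(3) _ gr(3,1)] hom_int_pow[OF M(4) _ gr(3,2)]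
        carr pq hom_in_carrier[OF M(2)] by simp_all
    moreover have "p (\<theta> (h x)) = \<phi> (f x) [^]\<^bsub>K\<^esub> i x" "q (\<theta> (h y)) = \<psi> (f y) [^]\<^bsub>L\<^esub> i y"
      using carr xy i pq hom_int_pow[OF K(2) _ G gr(1)] hom_int_pow[OF L(2) _ G gr(2)] by simp_all
    ultimately have "int (group.ord K (\<phi> (f x))) dvd k - i x" "int (group.ord L (\<psi> (f y))) dvd k - i y"
      using group.int_pow_eq[OF gr(1)] group.int_pow_eq[OF gr(2)] carr
        hom_in_carrier[OF K(2)] hom_in_carrier[OF L(2)] by metis+
    \<comment> \<open>Subtracting the two divisibilities eliminates \<open>k\<close> and contradicts
      the choice of \<open>m\<close>.\<close>
    then have "int m dvd k - i x" "int m dvd k - i y"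
      using K(3) L(3) by (meson dvd_trans of_nat_dvd_iff)+
    then have "int m dvd (k - i y) - (k - i x)" by (rule dvd_diff[rotated])
    then show False using ndvd by simp
  qed
  then show ?thesis using M(1,2) by blast
qed

end

section \<open>Wreath products with an acting group in the class\<close>

lemma sum_group_eqI:
  assumes "group A" "f \<in> carrier (sum_group I (\<lambda>_. A))" "g \<in> carrier (sum_group I (\<lambda>_. A))"
    and "\<And>x. x \<in> I \<Longrightarrow> f x = g x"
  shows "f = g"
  using assms by (auto simp: carrier_sum_group PiE_iff intro: extensionalityI)

lemma sum_group_apply_closed:
  "\<lbrakk>group A; f \<in> carrier (sum_group I (\<lambda>_. A)); x \<in> I\<rbrakk> \<Longrightarrow> f x \<in> carrier A"
  by (auto simp: carrier_sum_group)

lemma int_pow_sum_group: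
  assumes A: "group A" and f: "f \<in> carrier (sum_group I (\<lambda>_. A))" and x: "x \<in> I"
  shows "(f [^]\<^bsub>sum_group I (\<lambda>_. A)\<^esub> (k::int)) x = f x [^]\<^bsub>A\<^esub> k"
proof -
  have "(\<lambda>f. f x) \<in> hom (sum_group I (\<lambda>_. A)) A"
    using A x by (auto simp: hom_def carrier_sum_group)
  then show ?thesis using hom_int_pow[OF _ f _ A] A by fastforce
qed

lemma mem_wreath:
  "(f, b) \<in> carrier (A \<wr> B) \<longleftrightarrow> f \<in> carrier (sum_group (carrier B) (\<lambda>_. A)) \<and> b \<in> carrier B"
  by (simp add: wreath_def)

lemma mult_wreath:
  "(f, b) \<otimes>\<^bsub>A \<wr> B\<^esub> (f', b') =
    (\<lambda>x\<in>carrier B. f x \<otimes>\<^bsub>A\<^esub> f' (inv\<^bsub>B\<^esub> b \<otimes>\<^bsub>B\<^esub> x), b \<otimes>\<^bsub>B\<^esub> b')"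
  by (auto simp: wreath_def left_translate_def intro!: restrict_ext)

lemma one_wreath: "\<one>\<^bsub>A \<wr> B\<^esub> = (\<lambda>x\<in>carrier B. \<one>\<^bsub>A\<^esub>, \<one>\<^bsub>B\<^esub>)"
  by (simp add: wreath_def)

lemma snd_hom_wreath: "snd \<in> hom (A \<wr> B) B"
  by (auto simp: hom_def wreath_def)

lemma base_hom_wreath:
  assumes "group A" "group B"
  shows "(\<lambda>f. (f, \<one>\<^bsub>B\<^esub>)) \<in> hom (sum_group (carrier B) (\<lambda>_. A)) (A \<wr> B)"
proof -
  interpret B: group B by fact
  show ?thesis
    using sum_group[of "carrier B" "\<lambda>_. A"] assms(1)
    by (auto simp: hom_def mem_wreath mult_wreath intro!: restrict_ext)
qed

lemma int_pow_base_wreath: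
  assumes "group A" "group B" "f \<in> carrier (sum_group (carrier B) (\<lambda>_. A))"
  shows "(f, \<one>\<^bsub>B\<^esub>) [^]\<^bsub>A \<wr> B\<^esub> (k::int) = (f [^]\<^bsub>sum_group (carrier B) (\<lambda>_. A)\<^esub> k, \<one>\<^bsub>B\<^esub>)"
  using hom_int_pow[OF base_hom_wreath[OF assms(1,2)] assms(3) _ group_wreath[OF assms(1,2)], of k] assms(1)
  by simp

definition wreath_map :: "('a \<Rightarrow> 'c) \<Rightarrow> ('b, 'n) monoid_scheme \<Rightarrow> ('b \<Rightarrow> 'a) \<times> 'b \<Rightarrow> ('b \<Rightarrow> 'c) \<times> 'b"
  where "wreath_map \<phi> B = (\<lambda>(f, b). (\<lambda>x\<in>carrier B. \<phi> (f x), b))"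

lemma wreath_map_hom:
  assumes A: "group A" and B: "group B" and K: "group K" and \<phi>: "\<phi> \<in> hom A K"
  shows "wreath_map \<phi> B \<in> hom (A \<wr> B) (K \<wr> B)"
proof (rule homI)
  interpret B: group B by fact
  interpret \<phi>: group_hom A K \<phi> using A K \<phi> by (rule hom_group_hom)
  fix x assume "x \<in> carrier (A \<wr> B)"
  then obtain f b where x: "x = (f, b)" "f \<in> carrier (sum_group (carrier B) (\<lambda>_. A))" "b \<in> carrier B"
    by (cases x) (auto simp: mem_wreath)
  have "finite {i \<in> carrier B. \<phi> (f i) \<noteq> \<one>\<^bsub>K\<^esub>}"
    by (rule finite_subset[of _ "{i \<in> carrier B. f i \<noteq> \<one>\<^bsub>A\<^esub>}"])
      (use x(2) A in \<open>auto simp: carrier_sum_group\<close>)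
  then have "finite {i \<in> carrier B. (\<lambda>x\<in>carrier B. \<phi> (f x)) i \<noteq> \<one>\<^bsub>K\<^esub>}"
    by (rule rev_finite_subset) auto
  then show "wreath_map \<phi> B x \<in> carrier (K \<wr> B)"
    using x K sum_group_apply_closed[OF A x(2)]
    by (auto simp: wreath_map_def mem_wreath carrier_sum_group)
next
  interpret B: group B by fact
  interpret \<phi>: group_hom A K \<phi> using A K \<phi> by (rule hom_group_hom)
  fix x y assume "x \<in> carrier (A \<wr> B)" "y \<in> carrier (A \<wr> B)"
  then obtain f b f' b' where x: "x = (f, b)" "f \<in> carrier (sum_group (carrier B) (\<lambda>_. A))" "b \<in> carrier B"
    and y: "y = (f', b')" "f' \<in> carrier (sum_group (carrier B) (\<lambda>_. A))" "b' \<in> carrier B"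
    by (cases x, cases y) (auto simp: mem_wreath)
  show "wreath_map \<phi> B (x \<otimes>\<^bsub>A \<wr> B\<^esub> y) = wreath_map \<phi> B x \<otimes>\<^bsub>K \<wr> B\<^esub> wreath_map \<phi> B y"
    using x y sum_group_apply_closed[OF A x(2)] sum_group_apply_closed[OF A y(2)]
    by (auto simp: wreath_map_def mult_wreath intro!: restrict_ext)
qed

context extension_closed_pseudovariety
begin

text \<open>The kernel of \<open>snd\<close> is the base group, a sum of finitely many copies of
  \<open>K\<close> because \<open>B\<close> is finite. So the wreath product is an extension of
  groups in the class.\<close>

lemma in_class_wreath:
  assumes K: "in_class \<C> K" and B: "in_class \<C> B"
  shows "in_class \<C> (K \<wr> B)"
proof -
  note gr = in_class_group[OF K] in_class_group[OF B]
  interpret W: group "K \<wr> B" using gr by (rule group_wreath)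
  interpret \<pi>: group_hom "K \<wr> B" B snd
    by (rule hom_group_hom[OF W.is_group gr(2) snd_hom_wreath])
  show ?thesis
  proof (rule in_class_extension[OF W.is_group snd_hom_wreath B])
    let ?N = "(K \<wr> B)\<lparr>carrier := kernel (K \<wr> B) B snd\<rparr>"
    show "in_class \<C> ?N"
    proof (rule in_class_embed[OF _ in_class_sum_group[OF in_class_finite[OF B] K]])
      show "group ?N"
        using \<pi>.subgroup_kernel W.subgroup_imp_group by blast
      show "fst \<in> hom ?N (sum_group (carrier B) (\<lambda>_. K))"
        using gr(2) by (auto simp: hom_def kernel_def mem_wreath mult_wreath group.is_monoid
            monoid.inv_one monoid.l_one intro!: restrict_ext)
      show "inj_on fst (carrier ?N)"
        by (auto simp: inj_on_def kernel_def)
    qed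
  qed
qed

text \<open>If \<open>\<pi> h\<close> is not a power of \<open>\<pi> g\<close>, then
  \<open>Q\<close> separates. Otherwise some power of \<open>g\<close> times an element of the
  kernel equals \<open>h\<close>, and multiplication by a power of \<open>g\<close> affects neither
  membership in the cyclic subgroup nor separation from it.\<close>

lemma cyclic_subgroup_separable_via_kernel:
  assumes G: "group G" and Q: "group Q" "cyclic_subgroup_separable \<C> Q" and \<pi>: "\<pi> \<in> hom G Q"
    and sep: "\<And>g h. \<lbrakk>g \<in> carrier G; h \<in> carrier G; \<pi> h = \<one>\<^bsub>Q\<^esub>; \<And>k::int. h \<noteq> g [^]\<^bsub>G\<^esub> k\<rbrakk> \<Longrightarrow>
      \<exists>K\<in>\<C>. \<exists>\<phi>\<in>hom G K. \<forall>k::int. \<phi> h \<noteq> \<phi> g [^]\<^bsub>K\<^esub> k"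
  shows "cyclic_subgroup_separable \<C> G"
  unfolding cyclic_subgroup_separable_iff[OF G]
proof (intro ballI impI)
  interpret \<pi>: group_hom G Q \<pi> using G Q(1) \<pi> by (rule hom_group_hom)
  fix g h
  assume g: "g \<in> carrier G" and h: "h \<in> carrier G" and ne: "\<forall>k::int. h \<noteq> g [^]\<^bsub>G\<^esub> k"
  show "\<exists>K\<in>\<C>. \<exists>\<phi>\<in>hom G K. \<forall>k::int. \<phi> h \<noteq> \<phi> g [^]\<^bsub>K\<^esub> k"
  proof (cases "\<exists>k::int. \<pi> h = \<pi> g [^]\<^bsub>Q\<^esub> k")
    case False
    then show ?thesis using separation_via_hom[OF G Q \<pi> g h] by blast
  next
    case True
    then obtain k :: int where k: "\<pi> h = \<pi> g [^]\<^bsub>Q\<^esub> k" by blast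
    define h' where "h' = h \<otimes>\<^bsub>G\<^esub> g [^]\<^bsub>G\<^esub> (- k)"
    have h': "h' \<in> carrier G" using g h by (simp add: h'_def)
    have hh': "h = h' \<otimes>\<^bsub>G\<^esub> g [^]\<^bsub>G\<^esub> k"
      using g h by (simp add: h'_def \<pi>.G.m_assoc \<pi>.G.int_pow_neg)
    have "\<pi> h' = \<one>\<^bsub>Q\<^esub>"
      using g h k \<pi>.hom_int_pow[OF g] by (simp add: h'_def flip: \<pi>.H.int_pow_mult)
    moreover have "h' \<noteq> g [^]\<^bsub>G\<^esub> j" for j :: int
      using ne hh' g \<pi>.G.int_pow_mult by metis
    ultimately obtain K \<phi> where K: "K \<in> \<C>" "\<phi> \<in> hom G K" "\<forall>k::int. \<phi> h' \<noteq> \<phi> g [^]\<^bsub>K\<^esub> k"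
      using sep[OF g h'] by blast
    interpret \<phi>: group_hom G K \<phi> using K finite_groups G by (intro hom_group_hom) auto
    have "\<phi> h \<noteq> \<phi> g [^]\<^bsub>K\<^esub> j" for j :: int
    proof
      assume "\<phi> h = \<phi> g [^]\<^bsub>K\<^esub> j"
      then have "\<phi> h' = \<phi> g [^]\<^bsub>K\<^esub> (j + - k)"
        using g h \<phi>.hom_int_pow[OF g] \<phi>.H.int_pow_mult[of "\<phi> g" j "- k"] by (simp add: h'_def)
      then show False using K(3) by blast
    qed
    then show ?thesis using K(1,2) by blast
  qed
qed

lemma cyclic_subgroup_separable_wreath_in_class:
  assumes A: "group A" and css: "cyclic_subgroup_separable \<C> A" and B: "in_class \<C> B"
  shows "cyclic_subgroup_separable \<C> (A \<wr> B)"
proof (rule cyclic_subgroup_separable_via_kernel[OF group_wreath[OF A in_class_group[OF B]]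
      in_class_group[OF B] in_class_imp_cyclic_subgroup_separable[OF B] snd_hom_wreath])
  fix g h
  assume g: "g \<in> carrier (A \<wr> B)" and h: "h \<in> carrier (A \<wr> B)" "snd h = \<one>\<^bsub>B\<^esub>"
    and ne: "\<And>k::int. h \<noteq> g [^]\<^bsub>A \<wr> B\<^esub> k"
  note gB = in_class_group[OF B]
  let ?S = "sum_group (carrier B) (\<lambda>_. A)"
  interpret B: group B by fact
  interpret W: group "A \<wr> B" using A gB by (rule group_wreath)
  interpret \<pi>: group_hom "A \<wr> B" B snd by (rule hom_group_hom[OF W.is_group gB snd_hom_wreath])
  interpret S: group ?S using A by simp
  define n where "n = B.ord (snd g)"
  have sg: "snd g \<in> carrier B" using g by (rule \<pi>.hom_closed)
  have n: "snd (g [^]\<^bsub>A \<wr> B\<^esub> int n) = \<one>\<^bsub>B\<^esub>"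
    using \<pi>.hom_int_pow[OF g, of "int n"] sg by (simp add: n_def B.int_pow_eq_id)
  obtain F where F: "g [^]\<^bsub>A \<wr> B\<^esub> int n = (F, \<one>\<^bsub>B\<^esub>)" "F \<in> carrier ?S"
    using n W.int_pow_closed[OF g, of "int n"] by (metis mem_wreath prod.collapse)
  obtain u where u: "h = (u, \<one>\<^bsub>B\<^esub>)" "u \<in> carrier ?S"
    using h by (metis mem_wreath prod.collapse)
  \<comment> \<open>If one exponent \<open>k\<close> worked at all coordinates, \<open>h\<close>
    would be the power of \<open>g\<close> with exponent \<open>int n * k\<close>.\<close>
  have "\<exists>x\<in>carrier B. u x \<noteq> F x [^]\<^bsub>A\<^esub> k" for k :: int
  proof (rule ccontr)
    assume "\<not> ?thesis"
    then have "u = F [^]\<^bsub>?S\<^esub> k"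
      using F u by (auto intro!: sum_group_eqI[OF A] simp: int_pow_sum_group[OF A])
    then have "h = g [^]\<^bsub>A \<wr> B\<^esub> (int n * k)"
      using int_pow_base_wreath[OF A gB F(2), of k] u(1) F(1) W.int_pow_pow[OF g, of "int n" k] by simp
    then show False using ne by blast
  qed
  then obtain K \<phi> where K: "K \<in> \<C>" "\<phi> \<in> hom A K"
      and \<phi>: "\<And>k::int. \<exists>x\<in>carrier B. \<phi> (u x) \<noteq> \<phi> (F x) [^]\<^bsub>K\<^esub> k"
    using separation_family[OF A css in_class_finite[OF B], of F u]
      sum_group_apply_closed[OF A F(2)] sum_group_apply_closed[OF A u(2)] by blast
  have gK: "group K" using K(1) finite_groups by blast
  let ?\<Phi> = "wreath_map \<phi> B"
  have KB: "in_class \<C> (K \<wr> B)" by (rule in_class_wreath[OF in_class_member[OF K(1)] B])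
  interpret \<Phi>: group_hom "A \<wr> B" "K \<wr> B" ?\<Phi>
    by (rule hom_group_hom[OF W.is_group in_class_group[OF KB] wreath_map_hom[OF A gB gK K(2)]])
  have "?\<Phi> h \<noteq> ?\<Phi> g [^]\<^bsub>K \<wr> B\<^esub> k" for k :: int
  proof
    assume eq: "?\<Phi> h = ?\<Phi> g [^]\<^bsub>K \<wr> B\<^esub> k"
    then have "?\<Phi> h = ?\<Phi> (g [^]\<^bsub>A \<wr> B\<^esub> k)" using \<Phi>.hom_int_pow[OF g] by simp
    \<comment> \<open>\<open>wreath_map\<close> does not change the \<open>B\<close>-component, so
      only powers of \<open>g\<close> inside the base group, that is powers of \<open>F\<close>, can
      collide with \<open>h\<close>.\<close>
    then have "snd (g [^]\<^bsub>A \<wr> B\<^esub> k) = \<one>\<^bsub>B\<^esub>"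
      using h(2) by (simp add: wreath_map_def case_prod_beta)
    then have "int n dvd k"
      using \<pi>.hom_int_pow[OF g, of k] sg by (simp add: n_def B.int_pow_eq_id)
    then obtain j where j: "k = int n * j" by blast
    have "g [^]\<^bsub>A \<wr> B\<^esub> k = (F [^]\<^bsub>?S\<^esub> j, \<one>\<^bsub>B\<^esub>)"
      using W.int_pow_pow[OF g, of "int n" j] int_pow_base_wreath[OF A gB F(2)] F(1) j by simp
    then have "(\<lambda>x\<in>carrier B. \<phi> (u x)) = (\<lambda>x\<in>carrier B. \<phi> ((F [^]\<^bsub>?S\<^esub> j) x))"
      using \<open>?\<Phi> h = ?\<Phi> (g [^]\<^bsub>A \<wr> B\<^esub> k)\<close> u(1) by (simp add: wreath_map_def)
    then have "\<phi> (u x) = \<phi> (F x) [^]\<^bsub>K\<^esub> j" if "x \<in> carrier B" for x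
      using that int_pow_sum_group[OF A F(2) that] hom_int_pow[OF K(2) _ A gK]
        sum_group_apply_closed[OF A F(2) that] by (metis restrict_apply')
    then show False using \<phi>[of j] by blast
  qed
  then show "\<exists>K\<in>\<C>. \<exists>\<phi>\<in>hom (A \<wr> B) K. \<forall>k::int. \<phi> h \<noteq> \<phi> g [^]\<^bsub>K\<^esub> k"
    by (rule separation_via_hom[OF W.is_group in_class_group[OF KB]
        in_class_imp_cyclic_subgroup_separable[OF KB] \<Phi>.homh g h(1)])
qed

section \<open>Necessity\<close>

lemma comm_group_if_cyclic_subgroup_separable_wreath:
  assumes A: "group A" and B: "group B" and css: "cyclic_subgroup_separable \<C> (A \<wr> B)"
    and notin: "\<not> in_class \<C> B"
  shows "comm_group A"
proof -
  interpret A: group A by fact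
  interpret B: group B by fact
  interpret W: group "A \<wr> B" using A B by (rule group_wreath)
  \<comment> \<open>\<open>?s c\<close> places an element of \<open>A\<close> at the coordinate
    \<open>c\<close> of the base group, and \<open>?t\<close> embeds \<open>B\<close>.\<close>
  let ?\<delta> = "\<lambda>c a. (\<lambda>x\<in>carrier B. if x = c then a else \<one>\<^bsub>A\<^esub>)"
  let ?s = "\<lambda>c a. (?\<delta> c a, \<one>\<^bsub>B\<^esub>)" and ?t = "\<lambda>b. (\<lambda>x\<in>carrier B. \<one>\<^bsub>A\<^esub>, b)"
  have s: "?s c a \<in> carrier (A \<wr> B)" if "a \<in> carrier A" for c a
  proof -
    have "finite {x \<in> carrier B. ?\<delta> c a x \<noteq> \<one>\<^bsub>A\<^esub>}"
      by (rule finite_subset[of _ "{c}"]) auto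
    then show ?thesis using that A by (auto simp: mem_wreath carrier_sum_group)
  qed
  have t: "?t \<in> hom B (A \<wr> B)"
    using A by (auto simp: hom_def mem_wreath carrier_sum_group mult_wreath intro!: restrict_ext)
  have "a \<otimes>\<^bsub>A\<^esub> a' = a' \<otimes>\<^bsub>A\<^esub> a" if a: "a \<in> carrier A" "a' \<in> carrier A" for a a'
  proof -
    let ?x = "?s \<one>\<^bsub>B\<^esub> (a \<otimes>\<^bsub>A\<^esub> a')" and ?y = "?s \<one>\<^bsub>B\<^esub> (a' \<otimes>\<^bsub>A\<^esub> a)"
    \<comment> \<open>\<open>\<phi>\<close> distinguishes \<open>?x\<close> from \<open>?y\<close>
      if they differ, so it suffices to show that their images agree.\<close>
    obtain K \<phi> where K: "K \<in> \<C>" "\<phi> \<in> hom (A \<wr> B) K" "inj_on \<phi> {?x, ?y}"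
      using exists_hom_inj_on[OF W.is_group css, of "{?x, ?y}"] s a by auto
    interpret \<phi>: group_hom "A \<wr> B" K \<phi>
      using K finite_groups W.is_group by (intro hom_group_hom) auto
    have \<tau>: "\<phi> \<circ> ?t \<in> hom B K" using t K(2) by (rule hom_compose)
    interpret \<tau>: group_hom B K "\<phi> \<circ> ?t" by (rule hom_group_hom[OF B \<phi>.H.is_group \<tau>])
    \<comment> \<open>An injective restriction of \<open>\<phi>\<close> to the copy of
      \<open>B\<close> would put \<open>B\<close> in the class.\<close>
    have "\<not> inj_on (\<phi> \<circ> ?t) (carrier B)"
      using notin in_class_embed[OF B in_class_member[OF K(1)] \<tau>] by blast
    then obtain b where b: "b \<in> carrier B" "b \<noteq> \<one>\<^bsub>B\<^esub>" "\<phi> (?t b) = \<one>\<^bsub>K\<^esub>"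
      unfolding \<tau>.inj_on_one_iff by auto
    \<comment> \<open>Conjugation by \<open>?t b\<close> moves the copy of \<open>A\<close> at
      \<open>\<one>\<close> to the coordinate \<open>b\<close>, and \<open>\<phi>\<close> kills
      \<open>?t b\<close>.\<close>
    have move: "\<phi> (?s \<one>\<^bsub>B\<^esub> c) = \<phi> (?s b c)" if c: "c \<in> carrier A" for c
    proof -
      have "inv\<^bsub>B\<^esub> b \<otimes>\<^bsub>B\<^esub> x = \<one>\<^bsub>B\<^esub> \<longleftrightarrow> x = b" if "x \<in> carrier B" for x
        using that b(1) B.inv_solve_left'[of "\<one>\<^bsub>B\<^esub>" b x] by auto
      then have "?t b \<otimes>\<^bsub>A \<wr> B\<^esub> ?s \<one>\<^bsub>B\<^esub> c = ?s b c \<otimes>\<^bsub>A \<wr> B\<^esub> ?t b"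
        using b(1) c by (auto simp: mult_wreath intro!: restrict_ext)
      then have "\<phi> (?t b) \<otimes>\<^bsub>K\<^esub> \<phi> (?s \<one>\<^bsub>B\<^esub> c) = \<phi> (?s b c) \<otimes>\<^bsub>K\<^esub> \<phi> (?t b)"
        using s[OF c] hom_in_carrier[OF t b(1)] by (metis \<phi>.hom_mult)
      then show ?thesis using b(3) s[OF c] by simp
    qed
    have hom1: "\<phi> (?s \<one>\<^bsub>B\<^esub> (c \<otimes>\<^bsub>A\<^esub> d)) = \<phi> (?s \<one>\<^bsub>B\<^esub> c) \<otimes>\<^bsub>K\<^esub> \<phi> (?s \<one>\<^bsub>B\<^esub> d)"
      if "c \<in> carrier A" "d \<in> carrier A" for c d
    proof -
      have "?s \<one>\<^bsub>B\<^esub> (c \<otimes>\<^bsub>A\<^esub> d) = ?s \<one>\<^bsub>B\<^esub> c \<otimes>\<^bsub>A \<wr> B\<^esub> ?s \<one>\<^bsub>B\<^esub> d"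
        using that by (auto simp: mult_wreath intro!: restrict_ext)
      then show ?thesis using s that by (metis \<phi>.hom_mult)
    qed
    \<comment> \<open>Copies of \<open>A\<close> at distinct coordinates commute; by
      \<open>move\<close> this becomes commutation of the images of two elements at the coordinate
      \<open>\<one>\<close>.\<close>
    have "?s \<one>\<^bsub>B\<^esub> a \<otimes>\<^bsub>A \<wr> B\<^esub> ?s b a' = ?s b a' \<otimes>\<^bsub>A \<wr> B\<^esub> ?s \<one>\<^bsub>B\<^esub> a"
      using a b(2) by (auto simp: mult_wreath intro!: restrict_ext)
    then have "\<phi> (?s \<one>\<^bsub>B\<^esub> a) \<otimes>\<^bsub>K\<^esub> \<phi> (?s b a') = \<phi> (?s b a') \<otimes>\<^bsub>K\<^esub> \<phi> (?s \<one>\<^bsub>B\<^esub> a)"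
      using s a by (metis \<phi>.hom_mult)
    then have "\<phi> ?x = \<phi> ?y" using a hom1 move by simp
    then have "?x = ?y" using K(3) by (meson inj_onD insertI1 insertI2)
    then have "?\<delta> \<one>\<^bsub>B\<^esub> (a \<otimes>\<^bsub>A\<^esub> a') \<one>\<^bsub>B\<^esub> = ?\<delta> \<one>\<^bsub>B\<^esub> (a' \<otimes>\<^bsub>A\<^esub> a) \<one>\<^bsub>B\<^esub>"
      by (metis prod.inject)
    then show ?thesis by simp
  qed
  then show ?thesis by (rule A.group_comm_groupI)
qed

end

section \<open>Wreath products with an abelian base\<close>

text \<open>The map that \<open>\<beta>\<close> induces on wreath products with base
  \<open>A\<close>. A fibre of \<open>\<beta>\<close> may be infinite; \<open>gfinprod\<close>
  multiplies only over the finite support.\<close>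

definition wreath_push ::
    "('a, 'm) monoid_scheme \<Rightarrow> ('b, 'n) monoid_scheme \<Rightarrow> ('c, 'k) monoid_scheme \<Rightarrow> ('b \<Rightarrow> 'c) \<Rightarrow>
     ('b \<Rightarrow> 'a) \<times> 'b \<Rightarrow> ('c \<Rightarrow> 'a) \<times> 'c"
  where "wreath_push A B Q \<beta> = (\<lambda>(f, b).
    (\<lambda>q\<in>carrier Q. gfinprod A (\<lambda>x. if \<beta> x = q then f x else \<one>\<^bsub>A\<^esub>) (carrier B), \<beta> b))"

text \<open>The permutation \<open>p\<close> maps one support bijectively onto the other, so
  finiteness of the supports and the products over them agree. It will be a left
  translation.\<close>

lemma (in comm_monoid) gfinprod_reindex_bij:
  assumes "bij_betw p I I" "f \<in> I \<rightarrow> carrier G"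
  shows "gfinprod G (\<lambda>x. f (p x)) I = gfinprod G f I"
proof -
  have inj: "inj_on p I" and im: "p ` I = I" using assms(1) by (auto simp: bij_betw_def)
  have im': "p ` {x \<in> I. f (p x) \<noteq> \<one>} = {x \<in> I. f x \<noteq> \<one>}"
    by (subst (2) im[symmetric]) auto
  have inj': "inj_on p {x \<in> I. f (p x) \<noteq> \<one>}" using inj by (auto simp: inj_on_def)
  have "finite {x \<in> I. f (p x) \<noteq> \<one>} \<longleftrightarrow> finite {x \<in> I. f x \<noteq> \<one>}"
    using finite_image_iff[OF inj'] im' by simp
  moreover have "finprod G f (p ` {x \<in> I. f (p x) \<noteq> \<one>}) = finprod G (\<lambda>x. f (p x)) {x \<in> I. f (p x) \<noteq> \<one>}"
    by (rule finprod_reindex[OF _ inj']) (use assms im in auto)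
  ultimately show ?thesis unfolding gfinprod_def im' by simp
qed

text \<open>At most one factor of the fibre product is non-trivial. Hence a \<open>\<beta>\<close>
  that is injective on \<open>x\<close> and the support of \<open>f\<close> preserves the value at
  \<open>x\<close>.\<close>

lemma wreath_push_apply:
  assumes A: "comm_group A" and B: "group B" and Q: "group Q" and \<beta>: "\<beta> \<in> hom B Q"
    and f: "f \<in> carrier (sum_group (carrier B) (\<lambda>_. A))" and x: "x \<in> carrier B"
    and sep: "\<And>y. \<lbrakk>y \<in> carrier B; \<beta> y = \<beta> x; y \<noteq> x\<rbrakk> \<Longrightarrow> f y = \<one>\<^bsub>A\<^esub>"
  shows "fst (wreath_push A B Q \<beta> (f, b)) (\<beta> x) = f x"
proof -
  interpret A: comm_group A by fact
  have fA: "\<And>y. y \<in> carrier B \<Longrightarrow> f y \<in> carrier A"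
    by (rule sum_group_apply_closed[OF A.is_group f])
  let ?h = "\<lambda>y. if \<beta> y = \<beta> x then f y else \<one>\<^bsub>A\<^esub>"
  have "gfinprod A ?h {x} = gfinprod A ?h (carrier B)"
    by (rule A.gfinprod_mono_neutral_cong_left) (use x fA sep in auto)
  moreover have "gfinprod A ?h {x} = f x"
    using fA[OF x] by simp
  ultimately show ?thesis
    using hom_in_carrier[OF \<beta> x] by (simp add: wreath_push_def)
qed

text \<open>Fibre products are multiplicative because \<open>A\<close> is abelian, and they respect
  the action because translation by \<open>b\<close> permutes the fibres as \<open>\<beta> b\<close>
  permutes their indices. Finiteness of \<open>Q\<close> makes all supports finite.\<close>

lemma wreath_push_hom:
  assumes A: "comm_group A" and B: "group B" and Q: "group Q" "finite (carrier Q)" and \<beta>: "\<beta> \<in> hom B Q"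
  shows "wreath_push A B Q \<beta> \<in> hom (A \<wr> B) (A \<wr> Q)"
proof -
  interpret A: comm_group A by fact
  interpret B: group B by fact
  interpret \<beta>: group_hom B Q \<beta> using B Q(1) \<beta> by (rule hom_group_hom)
  let ?S = "sum_group (carrier B) (\<lambda>_. A)"
  let ?p = "\<lambda>f q. gfinprod A (\<lambda>x. if \<beta> x = q then f x else \<one>\<^bsub>A\<^esub>) (carrier B)"
  have fA: "f y \<in> carrier A" if "f \<in> carrier ?S" "y \<in> carrier B" for f y
    using sum_group_apply_closed[OF A.is_group that] .
  have p_hom: "(\<lambda>f. ?p f q) \<in> hom ?S A" for q
  proof -
    \<comment> \<open>The fibre product is a product of coordinate homomorphisms, each the identity
      on the fibre and trivial off it.\<close>
    have "(\<lambda>f. gfinprod A (\<lambda>x. (\<lambda>a. if \<beta> x = q then a else \<one>\<^bsub>A\<^esub>) (f x)) (carrier B)) \<in> hom ?S A"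
      by (rule A.hom_group_sum) (auto simp: hom_def)
    then show ?thesis .
  qed
  have p_translate: "?p (left_translate B b f) q = ?p f (inv\<^bsub>Q\<^esub> \<beta> b \<otimes>\<^bsub>Q\<^esub> q)"
    if b: "b \<in> carrier B" and f: "f \<in> carrier ?S" and q: "q \<in> carrier Q" for b f q
  proof -
    let ?m = "\<lambda>x. inv\<^bsub>B\<^esub> b \<otimes>\<^bsub>B\<^esub> x"
    have bij: "bij_betw ?m (carrier B) (carrier B)"
      by (rule bij_betw_byWitness[where f' = "\<lambda>x. b \<otimes>\<^bsub>B\<^esub> x"])
        (use b in \<open>auto simp flip: B.m_assoc\<close>)
    have "?p (left_translate B b f) q =
        gfinprod A (\<lambda>x. (\<lambda>y. if \<beta> y = inv\<^bsub>Q\<^esub> \<beta> b \<otimes>\<^bsub>Q\<^esub> q then f y else \<one>\<^bsub>A\<^esub>) (?m x)) (carrier B)"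
      using b q fA[OF f] by (intro A.gfinprod_cong) (auto simp: left_translate_def simp_implies_def)
    also have "\<dots> = ?p f (inv\<^bsub>Q\<^esub> \<beta> b \<otimes>\<^bsub>Q\<^esub> q)"
      by (rule A.gfinprod_reindex_bij[OF bij]) (use fA[OF f] in auto)
    finally show ?thesis .
  qed
  show ?thesis
  proof (rule homI)
    fix x assume "x \<in> carrier (A \<wr> B)"
    then obtain f b where x: "x = (f, b)" "f \<in> carrier ?S" "b \<in> carrier B"
      by (cases x) (auto simp: mem_wreath)
    have "?p f q \<in> carrier A" for q using hom_in_carrier[OF p_hom x(2)] .
    moreover have "finite {q \<in> carrier Q. P q}" for P using Q(2) by simp
    ultimately show "wreath_push A B Q \<beta> x \<in> carrier (A \<wr> Q)"
      using x A.is_group by (auto simp: wreath_push_def mem_wreath carrier_sum_group)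
  next
    fix x y assume "x \<in> carrier (A \<wr> B)" "y \<in> carrier (A \<wr> B)"
    then obtain f b f' b' where x: "x = (f, b)" "f \<in> carrier ?S" "b \<in> carrier B"
      and y: "y = (f', b')" "f' \<in> carrier ?S" "b' \<in> carrier B"
      by (cases x, cases y) (auto simp: mem_wreath)
    have t: "left_translate B b f' \<in> carrier ?S"
      by (rule left_translate_closed[OF A.is_group B x(3) y(2)])
    have "x \<otimes>\<^bsub>A \<wr> B\<^esub> y = (f \<otimes>\<^bsub>?S\<^esub> left_translate B b f', b \<otimes>\<^bsub>B\<^esub> b')"
      using x y by (simp add: wreath_def)
    then show "wreath_push A B Q \<beta> (x \<otimes>\<^bsub>A \<wr> B\<^esub> y) = wreath_push A B Q \<beta> x \<otimes>\<^bsub>A \<wr> Q\<^esub> wreath_push A B Q \<beta> y"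
      using x y hom_mult[OF p_hom x(2) t] p_translate[OF x(3) y(2)]
      by (auto simp: wreath_push_def mult_wreath simp del: mult_sum_group intro!: restrict_ext)
  qed
qed

context extension_closed_pseudovariety
begin

text \<open>The order of the \<open>B\<close>-component \<open>b\<close> of \<open>g\<close> decides
  what a finite quotient of \<open>B\<close> must preserve. If it is infinite, a witness that
  \<open>h\<close> does not commute with \<open>g\<close> is enough; if it is finite, the order
  itself and the supports of \<open>u\<close> and \<open>F\<close> are preserved.\<close>

lemma cyclic_subgroup_separable_wreath_comm_group:
  assumes A: "comm_group A" and cssA: "cyclic_subgroup_separable \<C> A"
    and B: "group B" and cssB: "cyclic_subgroup_separable \<C> B"
  shows "cyclic_subgroup_separable \<C> (A \<wr> B)"
proof (rule cyclic_subgroup_separable_via_kernel[OF group_wreath[OF comm_group.axioms(2)[OF A] B]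
      B cssB snd_hom_wreath])
  fix g h
  assume g: "g \<in> carrier (A \<wr> B)" and h: "h \<in> carrier (A \<wr> B)" "snd h = \<one>\<^bsub>B\<^esub>"
    and ne: "\<And>k::int. h \<noteq> g [^]\<^bsub>A \<wr> B\<^esub> k"
  interpret A: comm_group A by fact
  interpret B: group B by fact
  let ?S = "sum_group (carrier B) (\<lambda>_. A)"
  interpret S: group ?S using A.is_group by simp
  interpret W: group "A \<wr> B" using A.is_group B by (rule group_wreath)
  interpret \<pi>: group_hom "A \<wr> B" B snd by (rule hom_group_hom[OF W.is_group B snd_hom_wreath])
  define b where "b = snd g"
  have b: "b \<in> carrier B" using g unfolding b_def by (rule \<pi>.hom_closed)
  obtain f where gf: "g = (f, b)" "f \<in> carrier ?S" using g b_def by (metis mem_wreath prod.collapse)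
  obtain u where u: "h = (u, \<one>\<^bsub>B\<^esub>)" "u \<in> carrier ?S"
    using h by (metis mem_wreath prod.collapse)
  have uA: "u x \<in> carrier A" if "x \<in> carrier B" for x
    using sum_group_apply_closed[OF A.is_group u(2) that] .
  let ?supp = "\<lambda>f. {x \<in> carrier B. f x \<noteq> \<one>\<^bsub>A\<^esub>}"
  have fin: "finite (?supp f)" if "f \<in> carrier ?S" for f
    using that A.is_group by (simp add: carrier_sum_group)
  \<comment> \<open>A finite set \<open>S\<close> is wanted such that every \<open>\<beta>\<close>
    injective on \<open>S\<close> keeps the image of \<open>h\<close> out of the powers of the image
    of \<open>g\<close>. For \<open>Q\<close> in \<open>\<C>\<close> the target
    \<open>A \<wr> Q\<close> is separable by the previous case.\<close>
  have reduce: "\<exists>K\<in>\<C>. \<exists>\<phi>\<in>hom (A \<wr> B) K. \<forall>k::int. \<phi> h \<noteq> \<phi> g [^]\<^bsub>K\<^esub> k"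
    if S: "finite S" "S \<subseteq> carrier B"
      and sep: "\<And>(Q::nat monoid) \<beta>. \<lbrakk>group Q; group_hom B Q \<beta>; inj_on \<beta> S;
        group_hom (A \<wr> B) (A \<wr> Q) (wreath_push A B Q \<beta>)\<rbrakk> \<Longrightarrow>
        \<forall>k::int. wreath_push A B Q \<beta> h \<noteq> wreath_push A B Q \<beta> g [^]\<^bsub>A \<wr> Q\<^esub> k" for S
  proof -
    obtain Q \<beta> where Q: "Q \<in> \<C>" "\<beta> \<in> hom B Q" "inj_on \<beta> S"
      using exists_hom_inj_on[OF B cssB S] by blast
    have gQ: "group Q" "finite (carrier Q)" using Q(1) finite_groups by auto
    have gAQ: "group (A \<wr> Q)" using A.is_group gQ(1) by (rule group_wreath)
    note P = wreath_push_hom[OF A B gQ Q(2)]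
    show ?thesis
      using sep[OF gQ(1) hom_group_hom[OF B gQ(1) Q(2)] Q(3) hom_group_hom[OF W.is_group gAQ P]]
      by (intro separation_via_hom[OF W.is_group gAQ
            cyclic_subgroup_separable_wreath_in_class[OF A.is_group cssA in_class_member[OF Q(1)]] P g h(1)])
        blast
  qed
  show "\<exists>K\<in>\<C>. \<exists>\<phi>\<in>hom (A \<wr> B) K. \<forall>k::int. \<phi> h \<noteq> \<phi> g [^]\<^bsub>K\<^esub> k"
  proof (cases "B.ord b = 0")
    case True
    text \<open>A non-trivial \<open>u\<close> of finite support is not invariant under \<open>b\<close>, whereas \<open>(u, \<one>)\<close> would
      commute with \<open>g\<close>, hence be invariant under \<open>b\<close>, if it were a power of \<open>g\<close>.\<close>
    have "\<exists>x\<in>carrier B. u (inv\<^bsub>B\<^esub> b \<otimes>\<^bsub>B\<^esub> x) \<noteq> u x"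
    proof (rule ccontr)
      assume "\<not> ?thesis"
      then have inv: "u (inv\<^bsub>B\<^esub> b \<otimes>\<^bsub>B\<^esub> x) = u x" if "x \<in> carrier B" for x using that by blast
      have "h \<noteq> \<one>\<^bsub>A \<wr> B\<^esub>" using ne[of 0] by simp
      then obtain x where x: "x \<in> carrier B" "u x \<noteq> \<one>\<^bsub>A\<^esub>"
        using u sum_group_eqI[OF A.is_group u(2) group.is_monoid[THEN monoid.one_closed]] A.is_group
        by (fastforce simp: one_wreath)
      have "u ((inv\<^bsub>B\<^esub> b) [^]\<^bsub>B\<^esub> k \<otimes>\<^bsub>B\<^esub> x) = u x" for k :: nat
      proof (induction k)
        case (Suc k)
        have "(inv\<^bsub>B\<^esub> b) [^]\<^bsub>B\<^esub> Suc k \<otimes>\<^bsub>B\<^esub> x = inv\<^bsub>B\<^esub> b \<otimes>\<^bsub>B\<^esub> ((inv\<^bsub>B\<^esub> b) [^]\<^bsub>B\<^esub> k \<otimes>\<^bsub>B\<^esub> x)"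
          using b x(1) by (subst B.nat_pow_Suc2) (simp_all add: B.m_assoc)
        then show ?case using Suc inv[of "(inv\<^bsub>B\<^esub> b) [^]\<^bsub>B\<^esub> k \<otimes>\<^bsub>B\<^esub> x"] b x(1) by simp
      qed (use x in simp)
      \<comment> \<open>The orbit of \<open>x\<close> under \<open>b\<close> lies in the support of
        \<open>u\<close>, yet it is infinite: \<open>b\<close> has infinite order and translation is
        free.\<close>
      then have "range (\<lambda>k::nat. (inv\<^bsub>B\<^esub> b) [^]\<^bsub>B\<^esub> k \<otimes>\<^bsub>B\<^esub> x) \<subseteq> ?supp u"
        using b x by auto
      moreover have "inj (\<lambda>k::nat. (inv\<^bsub>B\<^esub> b) [^]\<^bsub>B\<^esub> k \<otimes>\<^bsub>B\<^esub> x)"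
      proof (rule injI)
        fix k l :: nat
        assume "(inv\<^bsub>B\<^esub> b) [^]\<^bsub>B\<^esub> k \<otimes>\<^bsub>B\<^esub> x = (inv\<^bsub>B\<^esub> b) [^]\<^bsub>B\<^esub> l \<otimes>\<^bsub>B\<^esub> x"
        then have "(inv\<^bsub>B\<^esub> b) [^]\<^bsub>B\<^esub> int k = (inv\<^bsub>B\<^esub> b) [^]\<^bsub>B\<^esub> int l"
          using b x by (simp add: int_pow_int)
        then show "k = l"
          using b True by (simp add: B.int_pow_eq B.ord_inv)
      qed
      ultimately show False
        using fin[OF u(2)] finite_subset range_inj_infinite by blast
    qed
    then obtain x where x: "x \<in> carrier B" "u (inv\<^bsub>B\<^esub> b \<otimes>\<^bsub>B\<^esub> x) \<noteq> u x" by blast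
    let ?y = "inv\<^bsub>B\<^esub> b \<otimes>\<^bsub>B\<^esub> x"
    show ?thesis
    \<comment> \<open>Injectivity on this set makes the pushed function take the values of
      \<open>u\<close> at the images of \<open>x\<close> and \<open>?y\<close>.\<close>
    proof (rule reduce[of "?supp u \<union> {x, ?y}"])
      fix Q :: "nat monoid" and \<beta>
      assume Q: "group Q" "group_hom B Q \<beta>" "inj_on \<beta> (?supp u \<union> {x, ?y})"
        "group_hom (A \<wr> B) (A \<wr> Q) (wreath_push A B Q \<beta>)"
      interpret \<beta>: group_hom B Q \<beta> by fact
      let ?P = "wreath_push A B Q \<beta>"
      interpret P: group_hom "A \<wr> B" "A \<wr> Q" ?P by fact
      have ux: "fst (?P h) (\<beta> z) = u z" if z: "z \<in> {x, ?y}" for z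
        unfolding u(1)
      proof (rule wreath_push_apply[OF A B Q(1) \<beta>.homh u(2)])
        show "z \<in> carrier B" using z x(1) b by auto
        show "u y = \<one>\<^bsub>A\<^esub>" if "y \<in> carrier B" "\<beta> y = \<beta> z" "y \<noteq> z" for y
          using inj_onD[OF Q(3) that(2)] that z by auto
      qed
      obtain f' where f': "?P g = (f', \<beta> b)" by (simp add: gf(1) wreath_push_def)
      obtain u' where u': "?P h = (u', \<one>\<^bsub>Q\<^esub>)" by (simp add: u(1) wreath_push_def)
      have carr: "f' \<in> carrier (sum_group (carrier Q) (\<lambda>_. A))"
        "u' \<in> carrier (sum_group (carrier Q) (\<lambda>_. A))"
        using P.hom_closed[OF g] P.hom_closed[OF h(1)] by (simp_all add: f' u' mem_wreath)
      have "?P h \<noteq> ?P g [^]\<^bsub>A \<wr> Q\<^esub> k" for k :: int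
      proof
        assume "?P h = ?P g [^]\<^bsub>A \<wr> Q\<^esub> k"
        \<comment> \<open>A power of \<open>?P g\<close> commutes with \<open>?P g\<close>;
          comparing the coordinates at \<open>\<beta> x\<close> and cancelling in the abelian group
          \<open>A\<close> gives \<open>u ?y = u x\<close>.\<close>
        then have "?P g \<otimes>\<^bsub>A \<wr> Q\<^esub> ?P h = ?P h \<otimes>\<^bsub>A \<wr> Q\<^esub> ?P g"
          using P.hom_closed[OF g] P.H.int_pow_mult[of "?P g" 1 k] P.H.int_pow_mult[of "?P g" k 1]
          by (simp add: add.commute)
        then have "(f' \<otimes>\<^bsub>sum_group (carrier Q) (\<lambda>_. A)\<^esub> left_translate Q (\<beta> b) u') (\<beta> x) =
            (u' \<otimes>\<^bsub>sum_group (carrier Q) (\<lambda>_. A)\<^esub> left_translate Q \<one>\<^bsub>Q\<^esub> f') (\<beta> x)"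
          unfolding f' u' by (simp add: wreath_def)
        then have "f' (\<beta> x) \<otimes>\<^bsub>A\<^esub> u' (\<beta> ?y) = u' (\<beta> x) \<otimes>\<^bsub>A\<^esub> f' (\<beta> x)"
          using x(1) b by (simp add: left_translate_def)
        then have "f' (\<beta> x) \<otimes>\<^bsub>A\<^esub> u ?y = f' (\<beta> x) \<otimes>\<^bsub>A\<^esub> u x"
          using ux[of x] ux[of ?y] u' x(1) uA sum_group_apply_closed[OF A.is_group carr(1)]
          by (simp add: A.m_comm)
        then show False
          using x b uA sum_group_apply_closed[OF A.is_group carr(1)] by simp
      qed
      then show "\<forall>k::int. ?P h \<noteq> ?P g [^]\<^bsub>A \<wr> Q\<^esub> k" by blast
    qed (use fin[OF u(2)] x b in auto)
  next
    case False
    define n where "n = B.ord b"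
    have n: "n > 0" using False by (simp add: n_def)
    have "snd (g [^]\<^bsub>A \<wr> B\<^esub> int n) = \<one>\<^bsub>B\<^esub>"
      using \<pi>.hom_int_pow[OF g, of "int n"] b by (simp add: n_def B.int_pow_eq_id flip: b_def)
    then obtain F where F: "g [^]\<^bsub>A \<wr> B\<^esub> int n = (F, \<one>\<^bsub>B\<^esub>)" "F \<in> carrier ?S"
      using W.int_pow_closed[OF g, of "int n"] by (metis mem_wreath prod.collapse)
    \<comment> \<open>The supports preserve the values of \<open>u\<close> and \<open>F\<close>; the
      powers of \<open>b\<close> make the order of \<open>\<beta> b\<close> equal to
      \<open>n\<close>.\<close>
    let ?T = "?supp u \<union> ?supp F \<union> (\<lambda>j. b [^]\<^bsub>B\<^esub> int j) ` {..<n}"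
    show ?thesis
    proof (rule reduce[of ?T])
      fix Q :: "nat monoid" and \<beta>
      assume Q: "group Q" "group_hom B Q \<beta>" "inj_on \<beta> ?T"
        "group_hom (A \<wr> B) (A \<wr> Q) (wreath_push A B Q \<beta>)"
      interpret \<beta>: group_hom B Q \<beta> by fact
      let ?P = "wreath_push A B Q \<beta>"
      interpret P: group_hom "A \<wr> B" "A \<wr> Q" ?P by fact
      have push: "fst (?P (v, c)) (\<beta> z) = v z"
        if "v \<in> {u, F}" "z \<in> ?supp u \<union> ?supp F" for v c z
      proof (rule wreath_push_apply[OF A B Q(1) \<beta>.homh])
        show "v \<in> carrier ?S" using that(1) u(2) F(2) by auto
        show "z \<in> carrier B" using that(2) by auto
        show "v y = \<one>\<^bsub>A\<^esub>" if "y \<in> carrier B" "\<beta> y = \<beta> z" "y \<noteq> z" for y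
          using inj_onD[OF Q(3) that(2)] that \<open>v \<in> {u, F}\<close> \<open>z \<in> ?supp u \<union> ?supp F\<close> by auto
      qed
      have "?P h \<noteq> ?P g [^]\<^bsub>A \<wr> Q\<^esub> k" for k :: int
      proof
        assume eq: "?P h = ?P g [^]\<^bsub>A \<wr> Q\<^esub> k"
        then have "?P h = ?P (g [^]\<^bsub>A \<wr> B\<^esub> k)" using P.hom_int_pow[OF g] by simp
        then have "\<beta> (snd (g [^]\<^bsub>A \<wr> B\<^esub> k)) = \<beta> (snd h)"
          by (simp add: wreath_push_def case_prod_beta)
        then have \<beta>k: "\<beta> (b [^]\<^bsub>B\<^esub> k) = \<beta> \<one>\<^bsub>B\<^esub>"
          using \<pi>.hom_int_pow[OF g, of k] h(2) by (simp flip: b_def)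
        \<comment> \<open>Reducing \<open>k\<close> modulo \<open>n\<close> brings the power of
          \<open>b\<close> into \<open>?T\<close>, which also contains \<open>\<one>\<close> as the
          power with exponent \<open>0\<close>, so injectivity applies.\<close>
        have km: "b [^]\<^bsub>B\<^esub> k = b [^]\<^bsub>B\<^esub> (k mod int n)"
          using b by (simp add: B.int_pow_eq n_def minus_mod_eq_mult_div mod_eq_dvd_iff dvd_minus_mod dvd_diff_commute)
        have "nat (k mod int n) \<in> {..<n}" "int (nat (k mod int n)) = k mod int n"
          using n by (auto simp: nat_less_iff)
        then have kT: "b [^]\<^bsub>B\<^esub> (k mod int n) \<in> ?T"
          by (intro UnI2 image_eqI[where x = "nat (k mod int n)"]) simp_all
        have "\<one>\<^bsub>B\<^esub> = b [^]\<^bsub>B\<^esub> int 0" by simp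
        then have "\<one>\<^bsub>B\<^esub> \<in> ?T" using n by blast
        then have "b [^]\<^bsub>B\<^esub> k = \<one>\<^bsub>B\<^esub>"
          unfolding km by (rule inj_onD[OF Q(3) \<beta>k[unfolded km] kT])
        then have "int n dvd k" using b by (simp add: n_def B.int_pow_eq_id)
        then obtain j where j: "k = int n * j" by blast
        have gk: "g [^]\<^bsub>A \<wr> B\<^esub> k = (F [^]\<^bsub>?S\<^esub> j, \<one>\<^bsub>B\<^esub>)"
          using W.int_pow_pow[OF g, of "int n" j] int_pow_base_wreath[OF A.is_group B F(2)] F(1) j by simp
        have Fcarr: "fst (?P (F, \<one>\<^bsub>B\<^esub>)) \<in> carrier (sum_group (carrier Q) (\<lambda>_. A))"
          using P.hom_closed[of "(F, \<one>\<^bsub>B\<^esub>)"] F(2) by (cases "?P (F, \<one>\<^bsub>B\<^esub>)") (auto simp: mem_wreath)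
        have P1: "?P (F, \<one>\<^bsub>B\<^esub>) = (fst (?P (F, \<one>\<^bsub>B\<^esub>)), \<one>\<^bsub>Q\<^esub>)"
          by (simp add: wreath_push_def)
        have "?P h = ?P ((F, \<one>\<^bsub>B\<^esub>) [^]\<^bsub>A \<wr> B\<^esub> j)"
          using \<open>?P h = ?P (g [^]\<^bsub>A \<wr> B\<^esub> k)\<close> gk int_pow_base_wreath[OF A.is_group B F(2)] by simp
        also have "\<dots> = ?P (F, \<one>\<^bsub>B\<^esub>) [^]\<^bsub>A \<wr> Q\<^esub> j"
          using F(2) by (intro P.hom_int_pow) (simp add: mem_wreath)
        also have "\<dots> = (fst (?P (F, \<one>\<^bsub>B\<^esub>)) [^]\<^bsub>sum_group (carrier Q) (\<lambda>_. A)\<^esub> j, \<one>\<^bsub>Q\<^esub>)"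
          using int_pow_base_wreath[OF A.is_group Q(1) Fcarr] P1 by metis
        finally have *: "fst (?P h) = fst (?P (F, \<one>\<^bsub>B\<^esub>)) [^]\<^bsub>sum_group (carrier Q) (\<lambda>_. A)\<^esub> j" by simp
        have "u x = F x [^]\<^bsub>A\<^esub> j" if x: "x \<in> carrier B" for x
        \<comment> \<open>Outside both supports the two sides are trivial; inside,
          \<open>push\<close> reads off the values from the equation in
          \<open>A \<wr> Q\<close>.\<close>
        proof (cases "x \<in> ?supp u \<union> ?supp F")
          case True
          have "u x = fst (?P h) (\<beta> x)" unfolding u(1) using push[of u] True by simp
          also have "\<dots> = fst (?P (F, \<one>\<^bsub>B\<^esub>)) (\<beta> x) [^]\<^bsub>A\<^esub> j"
            unfolding * using int_pow_sum_group[OF A.is_group Fcarr] x by simp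
          also have "\<dots> = F x [^]\<^bsub>A\<^esub> j" using push[of F] True by simp
          finally show ?thesis .
        next
          case False
          then show ?thesis using x by simp
        qed
        then have "u = F [^]\<^bsub>?S\<^esub> j"
          by (intro sum_group_eqI[OF A.is_group u(2) S.int_pow_closed[OF F(2)]])
            (simp add: int_pow_sum_group[OF A.is_group F(2)])
        then show False using ne[of k] gk u(1) by simp
      qed
      then show "\<forall>k::int. ?P h \<noteq> ?P g [^]\<^bsub>A \<wr> Q\<^esub> k" by blast
    qed (use fin[OF u(2)] fin[OF F(2)] b in auto)
  qed
qed

end

theorem proposition6p1:
  fixes \<C> :: "nat monoid set"
    and A :: "('a, 'm) monoid_scheme"
    and B :: "('b, 'n) monoid_scheme"
  assumes "extension_closed_pseudovariety \<C>"
    and "group A" and "group B"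
    and "carrier A \<noteq> {\<one>\<^bsub>A\<^esub>}" and "carrier B \<noteq> {\<one>\<^bsub>B\<^esub>}"
    and "cyclic_subgroup_separable \<C> A" and "cyclic_subgroup_separable \<C> B"
  shows "cyclic_subgroup_separable \<C> (A \<wr> B) \<longleftrightarrow> in_class \<C> B \<or> comm_group A"
proof -
  interpret extension_closed_pseudovariety \<C> by fact
  show ?thesis
    using assms(2,3,6,7) comm_group_if_cyclic_subgroup_separable_wreath
      cyclic_subgroup_separable_wreath_in_class cyclic_subgroup_separable_wreath_comm_group
    by blast
qed

end
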